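(* Given a bipartite graph $G=(S,T;E)$, a weight function $w:E\to\mathbb R_+$ and a positive integer $d$, one can find in polynomial time a permutation $s_1,\dots,s_n$ of $S$ and a maximum-weight cyclic $d$-distance matching $M$ with respect to this ordering such that $w(M)$ is the largest weight of a cyclic $d$-distance matching over all permutations of $S$.
   Context: For an ordering $s_1,\dots,s_n$ of $S$, a cyclic $d$-distance matching is an edge set $M\subseteq E$ such that every node of $S$ has degree at most $1$ in $M$ (nodes of $T$ have no degree bound) and whenever $s_it,s_jt\in M$ with $i\ne j$, both $|i-j|\ge d$ and $|i-j|\le n-d$. $w(M)=\sum_{e\in M}w(e)$. *)

theory Defs
  imports Complex_Main
    "HOL-Computational_Algebra.Polynomial"
    "HOL-Combinatorics.Multiset_Permutations"
begin

section \<open>Cyclic distance matchings\<close>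

text \<open>
  A bipartite graph with colour classes \<open>S\<close> and \<open>T\<close> is given by its edge set, a subset \<open>E\<close> of
  \<open>S \<times> T\<close>. An ordering of \<open>S\<close> is a list in \<^term>\<open>permutations_of_set S\<close>; since only differences of
  positions matter, counting positions from 0 agrees with counting them from 1. The differences are
  taken in the integers, so that there is no truncation, in particular when \<open>d > n\<close>.
\<close>

definition cyclic_distance_matching ::
    "nat \<Rightarrow> ('s \<times> 't) set \<Rightarrow> 's list \<Rightarrow> ('s \<times> 't) set \<Rightarrow> bool" where
  "cyclic_distance_matching d E \<sigma> M \<longleftrightarrow>
     M \<subseteq> E \<and>
     (\<forall>s \<in> set \<sigma>. card {e \<in> M. fst e = s} \<le> 1) \<and>
     (\<forall>i < length \<sigma>. \<forall>j < length \<sigma>. \<forall>t.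
        (\<sigma> ! i, t) \<in> M \<and> (\<sigma> ! j, t) \<in> M \<and> i \<noteq> j \<longrightarrow>
          int d \<le> \<bar>int i - int j\<bar> \<and> \<bar>int i - int j\<bar> \<le> int (length \<sigma>) - int d)"


section \<open>A random access machine with real arithmetic\<close>

text \<open>
  The weights are arbitrary real numbers, so running times are measured on a random access machine
  that handles natural numbers and exact reals. Programs are written in a deterministic while
  language whose memory consists of named arrays (a scalar is an array used at index 0 only).

  The operations are restricted so that the unit cost measure is not abused: there is no
  multiplication or division, the only real constant is 0, and there is no conversion between reals
  and natural numbers (reals influence the control flow only through comparisons). Hence numbers
  computed in \<open>t\<close> steps are integer combinations of the inputs (and, for natural numbers, of program
  constants) with coefficients of \<open>O(t)\<close> bits, and on rational inputs a polynomial number of steps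
  can be simulated in polynomial time on a Turing machine.
\<close>

type_synonym name = string

datatype nexp =
    NConst nat
  | NRead name nexp
  | NAdd nexp nexp
  | NSub nexp nexp

datatype rexp =
    RZero
  | RRead name nexp
  | RAdd rexp rexp
  | RSub rexp rexp

datatype bexp =
    NLess nexp nexp
  | RLess rexp rexp
  | BNot bexp
  | BAnd bexp bexp

datatype com =
    Skip
  | NWrite name nexp nexp
  | RWrite name nexp rexp
  | Seq com com
  | If bexp com com
  | While bexp com

record state =
  nmem :: "name \<Rightarrow> nat \<Rightarrow> nat"
  rmem :: "name \<Rightarrow> nat \<Rightarrow> real"

fun nval :: "nexp \<Rightarrow> state \<Rightarrow> nat" where
  "nval (NConst k) \<mu> = k"
| "nval (NRead x a) \<mu> = nmem \<mu> x (nval a \<mu>)"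
| "nval (NAdd a b) \<mu> = nval a \<mu> + nval b \<mu>"
| "nval (NSub a b) \<mu> = nval a \<mu> - nval b \<mu>"

fun rval :: "rexp \<Rightarrow> state \<Rightarrow> real" where
  "rval RZero \<mu> = 0"
| "rval (RRead x a) \<mu> = rmem \<mu> x (nval a \<mu>)"
| "rval (RAdd a b) \<mu> = rval a \<mu> + rval b \<mu>"
| "rval (RSub a b) \<mu> = rval a \<mu> - rval b \<mu>"

fun bval :: "bexp \<Rightarrow> state \<Rightarrow> bool" where
  "bval (NLess a b) \<mu> \<longleftrightarrow> nval a \<mu> < nval b \<mu>"
| "bval (RLess a b) \<mu> \<longleftrightarrow> rval a \<mu> < rval b \<mu>"
| "bval (BNot b) \<mu> \<longleftrightarrow> \<not> bval b \<mu>"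
| "bval (BAnd b c) \<mu> \<longleftrightarrow> bval b \<mu> \<and> bval c \<mu>"

definition nwrite :: "name \<Rightarrow> nat \<Rightarrow> nat \<Rightarrow> state \<Rightarrow> state" where
  "nwrite x i v \<mu> = \<mu>\<lparr>nmem := (nmem \<mu>)(x := (nmem \<mu> x)(i := v))\<rparr>"

definition rwrite :: "name \<Rightarrow> nat \<Rightarrow> real \<Rightarrow> state \<Rightarrow> state" where
  "rwrite x i v \<mu> = \<mu>\<lparr>rmem := (rmem \<mu>)(x := (rmem \<mu> x)(i := v))\<rparr>"

text \<open>
  \<open>exec c \<mu> t \<mu>'\<close>: started in memory \<open>\<mu>\<close>, the program \<open>c\<close> halts after \<open>t\<close> steps in memory \<open>\<mu>'\<close>.
  Every assignment and every test counts as one step. The expressions in a program have a fixed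
  size, so charging each operator separately would change \<open>t\<close> by a constant factor only.
\<close>

inductive exec :: "com \<Rightarrow> state \<Rightarrow> nat \<Rightarrow> state \<Rightarrow> bool" where
  Skip: "exec Skip \<mu> 1 \<mu>"
| NWrite: "exec (NWrite x a b) \<mu> 1 (nwrite x (nval a \<mu>) (nval b \<mu>) \<mu>)"
| RWrite: "exec (RWrite x a r) \<mu> 1 (rwrite x (nval a \<mu>) (rval r \<mu>) \<mu>)"
| Seq: "exec c1 \<mu>1 t1 \<mu>2 \<Longrightarrow> exec c2 \<mu>2 t2 \<mu>3 \<Longrightarrow> exec (Seq c1 c2) \<mu>1 (t1 + t2) \<mu>3"
| IfTrue: "bval b \<mu> \<Longrightarrow> exec c1 \<mu> t \<mu>' \<Longrightarrow> exec (If b c1 c2) \<mu> (t + 1) \<mu>'"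
| IfFalse: "\<not> bval b \<mu> \<Longrightarrow> exec c2 \<mu> t \<mu>' \<Longrightarrow> exec (If b c1 c2) \<mu> (t + 1) \<mu>'"
| WhileFalse: "\<not> bval b \<mu> \<Longrightarrow> exec (While b c) \<mu> 1 \<mu>"
| WhileTrue: "bval b \<mu>1 \<Longrightarrow> exec c \<mu>1 t1 \<mu>2 \<Longrightarrow> exec (While b c) \<mu>2 t2 \<mu>3 \<Longrightarrow>
    exec (While b c) \<mu>1 (t1 + t2 + 1) \<mu>3"

inductive_cases SkipE: "exec Skip \<mu> t \<mu>'"
inductive_cases NWriteE: "exec (NWrite x a b) \<mu> t \<mu>'"
inductive_cases RWriteE: "exec (RWrite x a r) \<mu> t \<mu>'"
inductive_cases SeqE: "exec (Seq c1 c2) \<mu> t \<mu>'"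
inductive_cases IfE: "exec (If b c1 c2) \<mu> t \<mu>'"
inductive_cases WhileE: "exec (While b c) \<mu> t \<mu>'"

text \<open>Execution is deterministic, so it is enough to assert that a suitable run exists.\<close>

lemma exec_deterministic:
  "exec c \<mu> t \<mu>1 \<Longrightarrow> exec c \<mu> t' \<mu>2 \<Longrightarrow> t' = t \<and> \<mu>2 = \<mu>1"
proof (induction arbitrary: t' \<mu>2 rule: exec.induct)
  case (Skip \<mu>)
  then show ?case by (rule SkipE) simp
next
  case (NWrite x a b \<mu>)
  then show ?case by (rule NWriteE) simp
next
  case (RWrite x a r \<mu>)
  then show ?case by (rule RWriteE) simp
next
  case (Seq c1 \<mu>1 t1 \<mu>2' c2 t2 \<mu>3)
  from Seq.prems show ?case by (rule SeqE) (metis Seq.IH)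
next
  case (IfTrue b \<mu> c1 t \<mu>' c2)
  from IfTrue.prems show ?case by (rule IfE) (metis IfTrue.IH IfTrue.hyps(1) Suc_eq_plus1)+
next
  case (IfFalse b \<mu> c2 t \<mu>' c1)
  from IfFalse.prems show ?case by (rule IfE) (metis IfFalse.IH IfFalse.hyps(1) Suc_eq_plus1)+
next
  case (WhileFalse b \<mu> c)
  from WhileFalse.prems show ?case by (rule WhileE) (simp_all add: WhileFalse.hyps)
next
  case (WhileTrue b \<mu>1 c t1 \<mu>2' t2 \<mu>3)
  from WhileTrue.prems show ?case
    by (rule WhileE) (metis WhileTrue.IH WhileTrue.hyps(1) Suc_eq_plus1)+
qed


section \<open>Encoding of inputs and outputs\<close>

definition index_of :: "'a list \<Rightarrow> 'a \<Rightarrow> nat" where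
  "index_of xs x = (LEAST i. i < length xs \<and> xs ! i = x)"

text \<open>
  A graph is presented by enumerations \<open>ss\<close>, \<open>ts\<close>, \<open>es\<close> of its two colour classes and of its edges.
  The machine receives the lengths of these lists and \<open>d\<close>, and for the \<open>i\<close>-th edge the indices of
  its two ends and its weight. All other memory cells are 0.
\<close>

definition input_state ::
    "'s list \<Rightarrow> 't list \<Rightarrow> ('s \<times> 't) list \<Rightarrow> ('s \<times> 't \<Rightarrow> real) \<Rightarrow> nat \<Rightarrow> state" where
  "input_state ss ts es w d =
    \<lparr>nmem = (\<lambda>x i.
       if x = ''n'' \<and> i = 0 then length ss
       else if x = ''m'' \<and> i = 0 then length ts
       else if x = ''k'' \<and> i = 0 then length es
       else if x = ''d'' \<and> i = 0 then d
       else if x = ''source'' \<and> i < length es then index_of ss (fst (es ! i))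
       else if x = ''target'' \<and> i < length es then index_of ts (snd (es ! i))
       else 0),
     rmem = (\<lambda>x i. if x = ''weight'' \<and> i < length es then w (es ! i) else 0)\<rparr>"

text \<open>
  The computed ordering is read off from the array \<open>order\<close>, which holds at index \<open>i\<close> the index in
  \<open>ss\<close> of the node at position \<open>i\<close>; the computed matching consists of the edges whose entry in the
  array \<open>matching\<close> is not 0. The value of \<open>output_order\<close> is meaningful only if the entries of
  \<open>order\<close> are valid indices.
\<close>

definition valid_output :: "'s list \<Rightarrow> state \<Rightarrow> bool" where
  "valid_output ss \<mu> \<longleftrightarrow> (\<forall>i < length ss. nmem \<mu> ''order'' i < length ss)"

definition output_order :: "'s list \<Rightarrow> state \<Rightarrow> 's list" where
  "output_order ss \<mu> = map (\<lambda>i. ss ! nmem \<mu> ''order'' i) [0..<length ss]"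

definition output_matching :: "('s \<times> 't) list \<Rightarrow> state \<Rightarrow> ('s \<times> 't) set" where
  "output_matching es \<mu> = {es ! i | i. i < length es \<and> nmem \<mu> ''matching'' i \<noteq> 0}"

end

theory Submission
  imports Defs
begin

text \<open>
  Let \<open>n\<close> be the size of \<open>S\<close> and \<open>b\<close> the maximum of 1 and \<open>n div d\<close>. In a cyclic \<open>d\<close>-distance matching every
  node of \<open>T\<close> has degree at most \<open>b\<close>, since \<open>k \<ge> 2\<close> positions on a cycle of length \<open>n\<close> that are
  pairwise \<open>d\<close> apart satisfy \<open>k d \<le> n\<close>. So no ordering does better than a maximum-weight edge set
  with degrees at most 1 in \<open>S\<close> and at most \<open>b\<close> in \<open>T\<close>, and such a set is found by the Hungarian method;
  prices certify that it is optimal.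

  Conversely, every such edge set is a cyclic \<open>d\<close>-distance matching for a suitable ordering. List \<open>S\<close>
  class by class, where a class consists of the nodes matched to the same node of \<open>T\<close>, beginning with the
  classes of size \<open>b\<close>. Write this list row by row into an array with \<open>b\<close> columns and read the array
  column by column. A class of size \<open>b\<close> is one row, a smaller class that runs over a row end leaves at
  least one column free between its two parts, and each column has at least \<open>d\<close> entries.
\<close>

section \<open>Total correctness and running time of programs\<close>

text \<open>The maximum with 1 in \<open>b\<close> is there because a single edge at a node of T
  obeys no distance condition, even if \<open>d > n\<close>. For \<open>b > 1\<close> the inequality
  \<open>b * d \<le> n\<close> holds; it is both the limit on the degrees and the reason why columns
  have \<open>d\<close> entries, so the two directions meet exactly and the ordering drops out of
  the optimization. The weights are arbitrary reals, so the running time must not depend on their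
  size. Progress is measured by combinatorial quantities alone: each node of S is the root of one
  search, each round of a search adds a saturated node of T to the alternating tree or ends the
  search, and the walk back to the root descends along times of discovery.\<close>

primrec nwrites :: "com \<Rightarrow> name set" where
  "nwrites Skip = {}"
| "nwrites (NWrite x a b) = {x}"
| "nwrites (RWrite x a r) = {}"
| "nwrites (Seq c1 c2) = nwrites c1 \<union> nwrites c2"
| "nwrites (If b c1 c2) = nwrites c1 \<union> nwrites c2"
| "nwrites (While b c) = nwrites c"

primrec rwrites :: "com \<Rightarrow> name set" where
  "rwrites Skip = {}"
| "rwrites (NWrite x a b) = {}"
| "rwrites (RWrite x a r) = {x}"
| "rwrites (Seq c1 c2) = rwrites c1 \<union> rwrites c2"
| "rwrites (If b c1 c2) = rwrites c1 \<union> rwrites c2"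
| "rwrites (While b c) = rwrites c"

text \<open>Thanks to this syntactic over-approximation of the changed names, a loop invariant has
  to speak only of what the loop changes.\<close>

definition frame :: "com \<Rightarrow> state \<Rightarrow> state \<Rightarrow> bool" where
  "frame c \<mu> \<mu>' \<longleftrightarrow> (\<forall>x. x \<notin> nwrites c \<longrightarrow> nmem \<mu>' x = nmem \<mu> x) \<and>
                  (\<forall>x. x \<notin> rwrites c \<longrightarrow> rmem \<mu>' x = rmem \<mu> x)"

lemma mem_write [simp]:
  "nmem (nwrite x i v \<mu>) = (nmem \<mu>)(x := (nmem \<mu> x)(i := v))"
  "rmem (nwrite x i v \<mu>) = rmem \<mu>"
  "nmem (rwrite x i r \<mu>) = nmem \<mu>"
  "rmem (rwrite x i r \<mu>) = (rmem \<mu>)(x := (rmem \<mu> x)(i := r))"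
  by (simp_all add: nwrite_def rwrite_def)

lemma frame_refl: "frame c \<mu> \<mu>"
  by (simp add: frame_def)

lemma frame_trans: "frame c \<mu>1 \<mu>2 \<Longrightarrow> frame c \<mu>2 \<mu>3 \<Longrightarrow> frame c \<mu>1 \<mu>3"
  by (simp add: frame_def)

lemma exec_frame: "exec c \<mu> t \<mu>' \<Longrightarrow> frame c \<mu> \<mu>'"
  by (induction rule: exec.induct) (auto simp: frame_def)

text \<open>\<open>poly (cost c) B\<close> bounds the running time of \<open>c\<close> if each of its loops makes at most \<open>B\<close>
  iterations whenever it is entered.\<close>

primrec cost :: "com \<Rightarrow> nat poly" where
  "cost Skip = 1"
| "cost (NWrite x a b) = 1"
| "cost (RWrite x a r) = 1"
| "cost (Seq c1 c2) = cost c1 + cost c2"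
| "cost (If b c1 c2) = cost c1 + cost c2 + 1"
| "cost (While b c) = [:0, 1:] * (cost c + 1) + 1"

text \<open>The time bound depends only on the syntax of \<open>c\<close> and on \<open>B\<close>,
  so sequencing adds no timing obligations. The one that remains is that every loop starts with a
  variant of at most \<open>B\<close>.\<close>

definition wp :: "nat \<Rightarrow> com \<Rightarrow> (state \<Rightarrow> bool) \<Rightarrow> state \<Rightarrow> bool" where
  "wp B c Q \<mu> \<longleftrightarrow> (\<exists>t \<mu>'. exec c \<mu> t \<mu>' \<and> t \<le> poly (cost c) B \<and> Q \<mu>')"

text \<open>Every use also supplies \<open>frame\<close>, and this is how facts about untouched
  memory are carried past a subprogram.\<close>

lemma wp_conseq:
  assumes "wp B c Q \<mu>" and "\<And>\<mu>'. frame c \<mu> \<mu>' \<Longrightarrow> Q \<mu>' \<Longrightarrow> Q' \<mu>'"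
  shows "wp B c Q' \<mu>"
  using assms exec_frame unfolding wp_def by blast

lemma wp_Skip: "Q \<mu> \<Longrightarrow> wp B Skip Q \<mu>"
  unfolding wp_def using exec.Skip by fastforce

lemma wp_NWrite: "Q (nwrite x (nval a \<mu>) (nval b \<mu>) \<mu>) \<Longrightarrow> wp B (NWrite x a b) Q \<mu>"
  unfolding wp_def using exec.NWrite by fastforce

lemma wp_RWrite: "Q (rwrite x (nval a \<mu>) (rval r \<mu>) \<mu>) \<Longrightarrow> wp B (RWrite x a r) Q \<mu>"
  unfolding wp_def using exec.RWrite by fastforce

lemma wp_Seq: "wp B c1 (wp B c2 Q) \<mu> \<Longrightarrow> wp B (Seq c1 c2) Q \<mu>"
  unfolding wp_def by (fastforce intro: exec.Seq add_mono)

lemma wp_If: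
  assumes "bval b \<mu> \<Longrightarrow> wp B c1 Q \<mu>" and "\<not> bval b \<mu> \<Longrightarrow> wp B c2 Q \<mu>"
  shows "wp B (If b c1 c2) Q \<mu>"
proof (cases "bval b \<mu>")
  case True
  then obtain t \<mu>' where "exec c1 \<mu> t \<mu>'" "t \<le> poly (cost c1) B" "Q \<mu>'"
    using assms(1) unfolding wp_def by blast
  then show ?thesis
    unfolding wp_def using True by (intro exI[of _ "t + 1"] exI[of _ \<mu>']) (auto intro: exec.IfTrue simp del: add_Suc_right Suc_eq_plus1 One_nat_def)
next
  case False
  then obtain t \<mu>' where "exec c2 \<mu> t \<mu>'" "t \<le> poly (cost c2) B" "Q \<mu>'"
    using assms(2) unfolding wp_def by blast
  then show ?thesis
    unfolding wp_def using False by (intro exI[of _ "t + 1"] exI[of _ \<mu>']) (auto intro: exec.IfFalse simp del: add_Suc_right Suc_eq_plus1 One_nat_def)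
qed

lemma wp_While:
  fixes V :: "state \<Rightarrow> nat"
  assumes init: "I \<mu>0" and bound: "V \<mu>0 \<le> B"
    and step: "\<And>\<mu>. frame c \<mu>0 \<mu> \<Longrightarrow> I \<mu> \<Longrightarrow> bval b \<mu> \<Longrightarrow>
      wp B c (\<lambda>\<mu>'. I \<mu>' \<and> V \<mu>' < V \<mu>) \<mu>"
    and exit: "\<And>\<mu>. frame c \<mu>0 \<mu> \<Longrightarrow> I \<mu> \<Longrightarrow> \<not> bval b \<mu> \<Longrightarrow> Q \<mu>"
  shows "wp B (While b c) Q \<mu>0"
proof -
  \<comment> \<open>The induction needs the current variant, which bounds the remaining rounds;
    \<open>B\<close> replaces it only at the end.\<close>
  have "\<exists>t \<mu>'. exec (While b c) \<mu> t \<mu>' \<and> t \<le> V \<mu> * (poly (cost c) B + 1) + 1 \<and> Q \<mu>'"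
    if "frame c \<mu>0 \<mu>" "I \<mu>" for \<mu>
    using that
  proof (induction "V \<mu>" arbitrary: \<mu> rule: less_induct)
    case less
    show ?case
    proof (cases "bval b \<mu>")
      case True
      then obtain t1 \<mu>1 where 1: "exec c \<mu> t1 \<mu>1" "t1 \<le> poly (cost c) B" "I \<mu>1" "V \<mu>1 < V \<mu>"
        using step less.prems unfolding wp_def by blast
      obtain t2 \<mu>2 where 2: "exec (While b c) \<mu>1 t2 \<mu>2"
        "t2 \<le> V \<mu>1 * (poly (cost c) B + 1) + 1" "Q \<mu>2"
        using less.hyps 1 frame_trans[OF less.prems(1) exec_frame] by blast
      have "(V \<mu>1 + 1) * (poly (cost c) B + 1) \<le> V \<mu> * (poly (cost c) B + 1)"
        using 1(4) by (intro mult_right_mono) auto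
      then have "t1 + t2 + 1 \<le> V \<mu> * (poly (cost c) B + 1) + 1"
        using 1(2) 2(2) by (simp add: algebra_simps)
      then show ?thesis using exec.WhileTrue[OF True 1(1) 2(1)] 2(3) by blast
    next
      case False
      then have "exec (While b c) \<mu> 1 \<mu>" "Q \<mu>"
        using exit less.prems by (auto intro: exec.WhileFalse simp del: One_nat_def)
      then show ?thesis by (meson le_add2)
    qed
  qed
  from this[OF frame_refl init] obtain t \<mu>' where
    "exec (While b c) \<mu>0 t \<mu>'" "t \<le> V \<mu>0 * (poly (cost c) B + 1) + 1" "Q \<mu>'" by blast
  moreover have "V \<mu>0 * (poly (cost c) B + 1) \<le> B * (poly (cost c) B + 1)"
    using bound by (rule mult_right_mono) simp
  ultimately show ?thesis unfolding wp_def by fastforce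
qed

abbreviation get :: "name \<Rightarrow> nexp" where
  "get x \<equiv> NRead x (NConst 0)"

abbreviation put :: "name \<Rightarrow> nexp \<Rightarrow> com" where
  "put x a \<equiv> NWrite x (NConst 0) a"

abbreviation seq :: "com \<Rightarrow> com \<Rightarrow> com" (infixr \<open>;;\<close> 55) where
  "c1 ;; c2 \<equiv> Seq c1 c2"

definition For :: "name \<Rightarrow> name \<Rightarrow> com \<Rightarrow> com" where
  "For i h c = (put i (NConst 0) ;;
    While (NLess (get i) (get h)) (c ;; put i (NAdd (get i) (NConst 1))))"

lemma nwrites_For [simp]: "nwrites (For i h c) = insert i (nwrites c)"
  and rwrites_For [simp]: "rwrites (For i h c) = rwrites c"
  by (auto simp: For_def)

text \<open>The test rereads \<open>h\<close> in every round, so the body must leave it alone, as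
  well as the counter. The invariant is demanded after the counter has been increased, in the state
  that the next test sees.\<close>

lemma wp_For:
  assumes names: "i \<notin> nwrites c" "h \<notin> nwrites c" "i \<noteq> h"
    and bound: "nmem \<mu>0 h 0 = H" "H \<le> B"
    and init: "I 0 (nwrite i 0 0 \<mu>0)"
    and step: "\<And>j \<mu>. frame (For i h c) \<mu>0 \<mu> \<Longrightarrow> nmem \<mu> i 0 = j \<Longrightarrow> j < H \<Longrightarrow> I j \<mu> \<Longrightarrow>
      wp B c (\<lambda>\<mu>'. I (Suc j) (nwrite i 0 (Suc j) \<mu>')) \<mu>"
    and exit: "\<And>\<mu>. frame (For i h c) \<mu>0 \<mu> \<Longrightarrow> I H \<mu> \<Longrightarrow> Q \<mu>"
  shows "wp B (For i h c) Q \<mu>0"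
proof -
  let ?b = "c ;; put i (NAdd (get i) (NConst 1))"
  let ?I = "\<lambda>\<mu>. nmem \<mu> i 0 \<le> H \<and> I (nmem \<mu> i 0) \<mu>"
  let ?\<mu> = "nwrite i 0 0 \<mu>0"
  have fr: "frame (For i h c) \<mu>0 \<mu>" "nmem \<mu> h 0 = H" if "frame ?b ?\<mu> \<mu>" for \<mu>
    using that names bound(1) by (auto simp: frame_def)
  have "wp B (While (NLess (get i) (get h)) ?b) Q ?\<mu>"
  proof (rule wp_While[where I = ?I and V = "\<lambda>\<mu>. H - nmem \<mu> i 0"])
    show "?I ?\<mu>" using init by simp
    show "H - nmem ?\<mu> i 0 \<le> B" using bound by simp
  next
    fix \<mu> assume a: "frame ?b ?\<mu> \<mu>" "?I \<mu>" "bval (NLess (get i) (get h)) \<mu>"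
    then have less: "nmem \<mu> i 0 < H" using fr by simp
    have "wp B c (\<lambda>\<mu>'. I (Suc (nmem \<mu> i 0)) (nwrite i 0 (Suc (nmem \<mu> i 0)) \<mu>')) \<mu>"
      using step[OF fr(1)[OF a(1)] refl less] a(2) by blast
    then show "wp B ?b (\<lambda>\<mu>'. ?I \<mu>' \<and> H - nmem \<mu>' i 0 < H - nmem \<mu> i 0) \<mu>"
      apply (intro wp_Seq)
      apply (erule wp_conseq)
      apply (rule wp_NWrite)
      using names less by (auto simp: frame_def)
  next
    fix \<mu> assume a: "frame ?b ?\<mu> \<mu>" "?I \<mu>" "\<not> bval (NLess (get i) (get h)) \<mu>"
    then have "nmem \<mu> i 0 = H" using fr by simp
    then show "Q \<mu>" using exit fr(1)[OF a(1)] a(2) by auto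
  qed
  then show ?thesis
    unfolding For_def by (intro wp_Seq wp_NWrite) simp
qed

section \<open>The Hungarian method with capacities\<close>

text \<open>Turns a sum of prices over edges into a sum over nodes weighted by degrees, where
  capacities can be compared.\<close>

lemma sum_by_value:
  fixes p :: "nat \<Rightarrow> real"
  assumes "finite F" and "\<And>e. e \<in> F \<Longrightarrow> g e \<le> (m :: nat)"
  shows "(\<Sum>e\<in>F. p (g e)) = (\<Sum>t\<le>m. real (card {e \<in> F. g e = t}) * p t)"
proof -
  have "(\<Sum>e\<in>F. p (g e)) = (\<Sum>t\<le>m. \<Sum>e\<in>{e \<in> F. g e = t}. p (g e))"
    using assms by (intro sum.group[symmetric]) auto
  also have "\<dots> = (\<Sum>t\<le>m. real (card {e \<in> F. g e = t}) * p t)"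
    by (intro sum.cong) auto
  finally show ?thesis .
qed

definition load :: "(nat \<Rightarrow> nat) \<Rightarrow> (nat \<Rightarrow> nat) \<Rightarrow> nat \<Rightarrow> nat \<Rightarrow> nat" where
  "load tgt f i t = card {s. s < i \<and> tgt (f s) = t}"

lemma load_0 [simp]: "load tgt f 0 t = 0"
  by (simp add: load_def)

lemma load_le: "load tgt f i t \<le> i"
  unfolding load_def using card_mono[of "{..<i}" "{s. s < i \<and> tgt (f s) = t}"] by auto

lemma load_extend: "load tgt (f(i := e)) (Suc i) t = load tgt f i t + (if tgt e = t then 1 else 0)"
proof -
  have "{s. s < Suc i \<and> tgt ((f(i := e)) s) = t} =
      (if tgt e = t then insert i {s. s < i \<and> tgt (f s) = t} else {s. s < i \<and> tgt (f s) = t})"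
    by (auto simp: less_Suc_eq)
  then show ?thesis by (simp add: load_def)
qed

text \<open>A balance with both corrections added avoids truncated subtraction and covers the case
  in which the old and the new edge of \<open>s\<close> have the same target.\<close>

lemma load_update:
  assumes "s < i"
  shows "load tgt (f(s := e)) i t + (if tgt (f s) = t then 1 else 0) =
    load tgt f i t + (if tgt e = t then 1 else 0)"
proof -
  let ?A = "{s'. s' < i \<and> s' \<noteq> s \<and> tgt (f s') = t}"
  have "load tgt g i t = card ?A + (if tgt (g s) = t then 1 else 0)"
    if "\<And>s'. s' \<noteq> s \<Longrightarrow> g s' = f s'" for g
  proof -
    have "s' < i \<and> tgt (g s') = t \<longleftrightarrow> (if s' = s then tgt (g s) = t else s' < i \<and> tgt (f s') = t)"
      for s' using assms that[of s'] by auto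
    then have "{s'. s' < i \<and> tgt (g s') = t} = (if tgt (g s) = t then insert s ?A else ?A)"
      by auto
    then show ?thesis by (simp add: load_def)
  qed
  from this[of f] this[of "f(s := e)"] show ?thesis by simp
qed

text \<open>Edges are numbered; besides the \<open>k\<close> edges of the graph there is for every node \<open>s\<close> an edge
  \<open>k + s\<close> of weight 0 to a node \<open>m\<close> that can never be saturated. So all nodes can be matched, one edge
  \<open>f s\<close> for each \<open>s\<close>.\<close>

locale assignment =
  fixes n m k :: nat and src tgt cap :: "nat \<Rightarrow> nat" and wt :: "nat \<Rightarrow> real"
  assumes src_less: "e < k + n \<Longrightarrow> src e < n"
    and tgt_le: "e < k + n \<Longrightarrow> tgt e \<le> m"
    and spare: "s < n \<Longrightarrow> src (k + s) = s \<and> tgt (k + s) = m \<and> wt (k + s) = 0"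
    and cap_spare: "n < cap m"
begin

section \<open>Dual solutions and weak duality\<close>

definition tight :: "(nat \<Rightarrow> real) \<Rightarrow> (nat \<Rightarrow> real) \<Rightarrow> nat \<Rightarrow> bool" where
  "tight u p e \<longleftrightarrow> wt e = u (src e) + p (tgt e)"

definition feasible :: "(nat \<Rightarrow> real) \<Rightarrow> (nat \<Rightarrow> real) \<Rightarrow> bool" where
  "feasible u p \<longleftrightarrow> (\<forall>e<k + n. wt e \<le> u (src e) + p (tgt e))"

definition tight_on :: "nat \<Rightarrow> (nat \<Rightarrow> nat) \<Rightarrow> (nat \<Rightarrow> real) \<Rightarrow> (nat \<Rightarrow> real) \<Rightarrow> bool" where
  "tight_on i f u p \<longleftrightarrow> (\<forall>s<i. f s < k + n \<and> src (f s) = s \<and> tight u p (f s))"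

definition slackness :: "(nat \<Rightarrow> nat) \<Rightarrow> (nat \<Rightarrow> real) \<Rightarrow> bool" where
  "slackness dg p \<longleftrightarrow> (\<forall>t\<le>m. 0 \<le> p t \<and> dg t \<le> cap t \<and> (0 < p t \<longrightarrow> dg t = cap t))"

text \<open>Only the nodes below \<open>i\<close> are matched, yet \<open>feasible\<close> concerns
  all edges, so nothing has to be rechecked when the next node enters. The degrees \<open>dg\<close>
  are a separate argument because the program stores them in an array of its own.\<close>

definition optimal_on ::
    "nat \<Rightarrow> (nat \<Rightarrow> nat) \<Rightarrow> (nat \<Rightarrow> real) \<Rightarrow> (nat \<Rightarrow> real) \<Rightarrow> (nat \<Rightarrow> nat) \<Rightarrow> bool" where
  "optimal_on i f u p dg \<longleftrightarrow> feasible u p \<and> tight_on i f u p \<and> slackness dg p \<and>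
     (\<forall>t\<le>m. dg t = load tgt f i t)"

text \<open>At most \<open>n\<close> nodes are matched and \<open>cap m\<close> is larger. Hence
  \<open>m\<close> never enters the tree and its price stays 0.\<close>

lemma spare_unsaturated:
  assumes "optimal_on i f u p dg" "i \<le> n"
  shows "dg m < cap m" "p m = 0"
proof -
  show 1: "dg m < cap m"
    using assms cap_spare load_le[of tgt f i m] by (auto simp: optimal_on_def)
  then show "p m = 0"
    using assms by (force simp: optimal_on_def slackness_def)
qed

text \<open>Weak duality: feasibility bounds \<open>sum wt F\<close> by potentials and prices, and
  their total over \<open>F\<close> is at most the total over \<open>f\<close>, whose edges are all
  tight. The capacities restrict \<open>F\<close> only below \<open>m\<close>, which is enough
  because \<open>p m = 0\<close>.\<close>

theorem optimal_weight:
  assumes opt: "optimal_on n f u p dg"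
    and F: "F \<subseteq> {..<k + n}" "inj_on src F" "\<And>t. t < m \<Longrightarrow> card {e \<in> F. tgt e = t} \<le> cap t"
  shows "sum wt F \<le> (\<Sum>s<n. wt (f s))"
proof -
  have fin: "finite F" using F(1) finite_subset by blast
  have feas: "\<And>e. e < k + n \<Longrightarrow> wt e \<le> u (src e) + p (tgt e)"
    and tight: "\<And>s. s < n \<Longrightarrow> f s < k + n \<and> src (f s) = s \<and> wt (f s) = u s + p (tgt (f s))"
    and dual: "\<And>t. t \<le> m \<Longrightarrow> 0 \<le> p t \<and> (0 < p t \<longrightarrow> load tgt f n t = cap t)"
    using opt by (auto simp: optimal_on_def feasible_def tight_on_def tight_def slackness_def)
  have pm: "p m = 0" using spare_unsaturated[OF opt] by simp
  \<comment> \<open>The spare edge of \<open>s\<close> has weight 0 and ends at a node of price 0.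
    Nonnegativity allows the sum to be extended from the sources of \<open>F\<close> to all
    nodes.\<close>
  have u: "0 \<le> u s" if "s < n" for s
    using feas[of "k + s"] spare[OF that] that pm by simp
  have "sum wt F \<le> (\<Sum>e\<in>F. u (src e) + p (tgt e))"
    using F(1) feas by (intro sum_mono) auto
  also have "\<dots> = sum u (src ` F) + (\<Sum>e\<in>F. p (tgt e))"
    using F(2) by (simp add: sum.distrib sum.reindex)
  also have "sum u (src ` F) \<le> sum u {..<n}"
    using F(1) src_less u by (intro sum_mono2) auto
  also have "(\<Sum>e\<in>F. p (tgt e)) = (\<Sum>t\<le>m. real (card {e \<in> F. tgt e = t}) * p t)"
    using fin F(1) tgt_le by (intro sum_by_value) auto
  also have "\<dots> \<le> (\<Sum>t\<le>m. real (card {s \<in> {..<n}. tgt (f s) = t}) * p t)"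
  proof (rule sum_mono)
    fix t assume "t \<in> {..m}"
    \<comment> \<open>A positive price forces \<open>load tgt f n t = cap t\<close>, so no
      admissible \<open>F\<close> has a larger degree at such a node.\<close>
    then have "0 < p t \<Longrightarrow> card {e \<in> F. tgt e = t} \<le> card {s \<in> {..<n}. tgt (f s) = t}" "0 \<le> p t"
      using dual[of t] F(3)[of t] pm by (auto simp: load_def le_less)
    then show "real (card {e \<in> F. tgt e = t}) * p t \<le> real (card {s \<in> {..<n}. tgt (f s) = t}) * p t"
      by (cases "p t = 0") (auto intro!: mult_right_mono)
  qed
  also have "\<dots> = (\<Sum>s<n. p (tgt (f s)))"
    using tight tgt_le by (intro sum_by_value[symmetric]) auto
  also have "sum u {..<n} + (\<Sum>s<n. p (tgt (f s))) = (\<Sum>s<n. wt (f s))"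
    using tight by (simp add: sum.distrib[symmetric])
  finally show ?thesis by simp
qed

text \<open>The alternating tree of tight edges that grows from the root \<open>i\<close>. For \<open>t\<close> in the tree \<open>vt t\<close> is its
  time of discovery, and \<open>pv t\<close> the edge through which it was discovered.\<close>

definition tree_nodes :: "nat \<Rightarrow> (nat \<Rightarrow> nat) \<Rightarrow> (nat \<Rightarrow> nat) \<Rightarrow> (nat \<Rightarrow> nat) \<Rightarrow> bool" where
  "tree_nodes i f vs vt \<longleftrightarrow> (\<forall>s<n. vs s \<noteq> 0 \<longleftrightarrow> s = i \<or> s < i \<and> vt (tgt (f s)) \<noteq> 0)"

text \<open>The root \<open>i\<close> has no edge yet, hence the distinction between
  \<open>src (pv t) = i\<close> and \<open>src (pv t) < i\<close>. In the latter case the node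
  matched to that source was discovered strictly earlier, so following \<open>pv\<close> and
  \<open>f\<close> backwards reaches the root.\<close>

definition discovered ::
    "nat \<Rightarrow> (nat \<Rightarrow> nat) \<Rightarrow> (nat \<Rightarrow> real) \<Rightarrow> (nat \<Rightarrow> real) \<Rightarrow> (nat \<Rightarrow> nat) \<Rightarrow> (nat \<Rightarrow> nat) \<Rightarrow> nat \<Rightarrow> bool"
  where "discovered i f u p vt pv t \<longleftrightarrow> pv t < k + n \<and> tgt (pv t) = t \<and> tight u p (pv t) \<and>
     src (pv t) \<le> i \<and>
     (src (pv t) < i \<longrightarrow> 0 < vt (tgt (f (src (pv t)))) \<and> vt (tgt (f (src (pv t)))) < vt t)"

text \<open>All tree nodes are saturated, which is why their prices may be raised without violating
  \<open>slackness\<close>.\<close>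

definition tree ::
    "nat \<Rightarrow> (nat \<Rightarrow> nat) \<Rightarrow> (nat \<Rightarrow> real) \<Rightarrow> (nat \<Rightarrow> real) \<Rightarrow> (nat \<Rightarrow> nat) \<Rightarrow>
      (nat \<Rightarrow> nat) \<Rightarrow> (nat \<Rightarrow> nat) \<Rightarrow> (nat \<Rightarrow> nat) \<Rightarrow> nat \<Rightarrow> bool" where
  "tree i f u p dg vs vt pv c \<longleftrightarrow>
     optimal_on i f u p dg \<and> tree_nodes i f vs vt \<and> c = card {t. t \<le> m \<and> vt t \<noteq> 0} \<and>
     (\<forall>t\<le>m. vt t \<noteq> 0 \<longrightarrow> vt t \<le> c \<and> dg t = cap t \<and> discovered i f u p vt pv t)"

definition frontier :: "(nat \<Rightarrow> nat) \<Rightarrow> (nat \<Rightarrow> nat) \<Rightarrow> nat \<Rightarrow> bool" where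
  "frontier vs vt e \<longleftrightarrow> e < k + n \<and> vs (src e) \<noteq> 0 \<and> vt (tgt e) = 0"

definition slack :: "(nat \<Rightarrow> real) \<Rightarrow> (nat \<Rightarrow> real) \<Rightarrow> nat \<Rightarrow> real" where
  "slack u p e = u (src e) + p (tgt e) - wt e"

lemma tree_init:
  assumes "optimal_on i f u p dg" "i < n" "\<forall>s<n. vs s = (if s = i then 1 else 0)" "\<forall>t\<le>m. vt t = 0"
  shows "tree i f u p dg vs vt pv 0"
proof -
  have "tgt (f s) \<le> m" if "s < i" for s
    using assms(1) that tgt_le by (auto simp: optimal_on_def tight_on_def)
  then have "tree_nodes i f vs vt" using assms(2-4) by (auto simp: tree_nodes_def)
  then show ?thesis using assms by (auto simp: tree_def)
qed

text \<open>The unsaturated node \<open>m\<close> lies outside the tree, which leaves the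
  \<open>m\<close> nodes below it. This bounds the rounds of a search.\<close>

lemma tree_count_le:
  assumes "tree i f u p dg vs vt pv c" "i \<le> n"
  shows "c \<le> m"
proof -
  have "vt m = 0" using assms spare_unsaturated(1) unfolding tree_def by fastforce
  then have "{t. t \<le> m \<and> vt t \<noteq> 0} \<subseteq> {..<m}" by (auto simp: le_less)
  from card_mono[OF _ this] show ?thesis using assms(1) by (simp add: tree_def)
qed

text \<open>The spare edge of the root always leaves the tree, so the frontier is nonempty and
  \<open>scan\<close> has an initial candidate for the minimum.\<close>

lemma frontier_spare:
  assumes "tree i f u p dg vs vt pv c" "i < n"
  shows "frontier vs vt (k + i)"
proof -
  have "vt m = 0" using assms spare_unsaturated(1)[of i] unfolding tree_def by fastforce
  moreover have "vs i \<noteq> 0" using assms by (simp add: tree_def tree_nodes_def)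
  ultimately show ?thesis using assms(2) spare by (simp add: frontier_def)
qed

section \<open>Price changes, growth of the tree and augmentation\<close>

definition lower :: "(nat \<Rightarrow> nat) \<Rightarrow> real \<Rightarrow> (nat \<Rightarrow> real) \<Rightarrow> nat \<Rightarrow> real" where
  "lower vs \<delta> u s = (if s < n \<and> vs s \<noteq> 0 then u s - \<delta> else u s)"

text \<open>The range conditions here and in \<open>lower\<close> are those of the loops in
  \<open>reprice\<close>, so the updated arrays agree with these functions at every index.\<close>

definition raise :: "(nat \<Rightarrow> nat) \<Rightarrow> real \<Rightarrow> (nat \<Rightarrow> real) \<Rightarrow> nat \<Rightarrow> real" where
  "raise vt \<delta> p t = (if t \<le> m \<and> vt t \<noteq> 0 then p t + \<delta> else p t)"

text \<open>The slack drops by \<open>\<delta>\<close> on frontier edges, where it is at least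
  \<open>\<delta>\<close>; it grows on edges that enter the tree from a source outside and stays the
  same elsewhere. Matching edges and discovery edges have both ends in the tree or both outside, so
  they stay tight. The case \<open>\<delta> = 0\<close> is included.\<close>

lemma tree_reprice:
  assumes tree: "tree i f u p dg vs vt pv c" and i: "i < n"
    and e: "frontier vs vt e" "\<And>e'. frontier vs vt e' \<Longrightarrow> slack u p e \<le> slack u p e'"
    and \<delta>: "\<delta> = slack u p e"
  shows "tree i f (lower vs \<delta> u) (raise vt \<delta> p) dg vs vt pv c" (is "tree i f ?u ?p dg vs vt pv c")
    and "tight (lower vs \<delta> u) (raise vt \<delta> p) e"
proof -
  have opt: "feasible u p" "tight_on i f u p" "slackness dg p" "\<forall>t\<le>m. dg t = load tgt f i t"
    and nodes: "tree_nodes i f vs vt"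
    and disc: "\<And>t. t \<le> m \<Longrightarrow> vt t \<noteq> 0 \<Longrightarrow> dg t = cap t \<and> discovered i f u p vt pv t"
    using tree by (auto simp: tree_def optimal_on_def)
  have \<delta>0: "0 \<le> \<delta>"
    using opt(1) e(1) \<delta> by (auto simp: feasible_def frontier_def slack_def)
  show "tight ?u ?p e"
    using e(1) \<delta> src_less[of e] tgt_le[of e]
    by (simp add: frontier_def tight_def lower_def raise_def slack_def)
  have keep: "tight ?u ?p e'" if "tight u p e'" "e' < k + n" "vs (src e') \<noteq> 0 \<longleftrightarrow> vt (tgt e') \<noteq> 0" for e'
    using that src_less[of e'] tgt_le[of e'] by (auto simp: tight_def lower_def raise_def)
  have "feasible ?u ?p"
    unfolding feasible_def
  proof (intro allI impI)
    fix e' assume e': "e' < k + n"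
    show "wt e' \<le> ?u (src e') + ?p (tgt e')"
    proof (cases "frontier vs vt e'")
      case True
      then show ?thesis
        using e(2)[OF True] \<delta> src_less[of e'] tgt_le[of e']
        by (simp add: frontier_def lower_def raise_def slack_def)
    next
      case False
      have "wt e' \<le> u (src e') + p (tgt e')" using opt(1) e' by (simp add: feasible_def)
      then show ?thesis
        using False \<delta>0 e' src_less[of e'] tgt_le[of e']
        by (auto simp: frontier_def lower_def raise_def)
    qed
  qed
  moreover have "tight_on i f ?u ?p"
    unfolding tight_on_def
  proof (intro allI impI)
    fix s assume "s < i"
    then show "f s < k + n \<and> src (f s) = s \<and> tight ?u ?p (f s)"
      using opt(2) nodes i keep[of "f s"] by (auto simp: tight_on_def tree_nodes_def)
  qed
  moreover have "slackness dg ?p"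
    using opt(3) disc \<delta>0 by (auto simp: slackness_def raise_def)
  moreover have "discovered i f ?u ?p vt pv t" if "t \<le> m" "vt t \<noteq> 0" for t
  proof -
    have d: "discovered i f u p vt pv t" using disc that by blast
    then have "vs (src (pv t)) \<noteq> 0"
      using nodes i src_less[of "pv t"] by (auto simp: discovered_def tree_nodes_def)
    then show ?thesis using d keep[of "pv t"] that by (simp add: discovered_def)
  qed
  ultimately show "tree i f ?u ?p dg vs vt pv c"
    using tree unfolding tree_def optimal_on_def by blast
qed

text \<open>A saturated target may be matched to several nodes, and all of them join the tree.
  \<open>Suc c\<close> exceeds every earlier time of discovery, so the new node can be traced
  back.\<close>

lemma tree_grow:
  assumes tree: "tree i f u p dg vs vt pv c" and i: "i < n"
    and e: "frontier vs vt e" "tight u p e" and t: "t = tgt e" "cap t \<le> dg t"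
    and vs': "\<forall>s<n. vs' s = (if s < i \<and> tgt (f s) = t then 1 else vs s)"
  shows "tree i f u p dg vs' (vt(t := Suc c)) (pv(t := e)) (Suc c)"
proof -
  let ?vt = "vt(t := Suc c)" and ?pv = "pv(t := e)"
  have opt: "optimal_on i f u p dg" and nodes: "tree_nodes i f vs vt"
    and c: "c = card {t. t \<le> m \<and> vt t \<noteq> 0}"
    and disc: "\<And>t. t \<le> m \<Longrightarrow> vt t \<noteq> 0 \<Longrightarrow> vt t \<le> c \<and> dg t = cap t \<and> discovered i f u p vt pv t"
    using tree by (auto simp: tree_def)
  have tm: "t \<le> m" and vt0: "vt t = 0" and src: "src e < n" "vs (src e) \<noteq> 0"
    using e(1) t(1) tgt_le src_less by (auto simp: frontier_def)
  have tgts: "tgt (f s) \<le> m" if "s < i" for s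
    using opt that tgt_le by (auto simp: optimal_on_def tight_on_def)
  have "{t'. t' \<le> m \<and> ?vt t' \<noteq> 0} = insert t {t'. t' \<le> m \<and> vt t' \<noteq> 0}"
    using tm by auto
  then have "Suc c = card {t'. t' \<le> m \<and> ?vt t' \<noteq> 0}" using c vt0 by simp
  moreover have "tree_nodes i f vs' ?vt"
    using nodes vs' i vt0 by (auto simp: tree_nodes_def)
  moreover have "?vt t' \<le> Suc c \<and> dg t' = cap t' \<and> discovered i f u p ?vt ?pv t'"
    if t': "t' \<le> m" "?vt t' \<noteq> 0" for t'
  proof (cases "t' = t")
    case True
    have "dg t = cap t"
      using opt t(2) tm by (auto simp: optimal_on_def slackness_def)
    moreover have "src e \<le> i \<and> (src e < i \<longrightarrow> 0 < vt (tgt (f (src e))))"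
      using nodes src by (auto simp: tree_nodes_def)
    moreover have "vt (tgt (f (src e))) \<le> c" if "src e < i"
      using disc[OF tgts[OF that]] by (cases "vt (tgt (f (src e))) = 0") auto
    ultimately show ?thesis
      using True e t(1) vt0 by (auto simp: discovered_def frontier_def less_Suc_eq_le)
  next
    case False
    then have "vt t' \<le> c \<and> dg t' = cap t' \<and> discovered i f u p vt pv t'"
      using disc t' by simp
    \<comment> \<open>The predecessor of \<open>t'\<close> has a nonzero time of discovery while
      \<open>vt t = 0\<close>, so setting \<open>vt\<close> at \<open>t\<close> does not disturb
      it.\<close>
    moreover from this have "src (pv t') < i \<Longrightarrow> tgt (f (src (pv t'))) \<noteq> t"
      using vt0 by (auto simp: discovered_def)
    ultimately show ?thesis
      using False by (simp add: discovered_def)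
  qed
  ultimately show ?thesis using opt by (simp add: tree_def)
qed

text \<open>While the path to the root is flipped, \<open>e\<close> is the edge about to be inserted. Only the part
  of the tree discovered before its source matters from then on, and there \<open>f\<close> is unchanged.\<close>

definition flipping ::
    "nat \<Rightarrow> (nat \<Rightarrow> nat) \<Rightarrow> (nat \<Rightarrow> real) \<Rightarrow> (nat \<Rightarrow> real) \<Rightarrow> (nat \<Rightarrow> nat) \<Rightarrow>
      (nat \<Rightarrow> nat) \<Rightarrow> (nat \<Rightarrow> nat) \<Rightarrow> nat \<Rightarrow> bool" where
  "flipping i f u p dg vt pv e \<longleftrightarrow>
     feasible u p \<and> tight_on i f u p \<and> slackness dg p \<and>
     (\<forall>t\<le>m. dg t = load tgt f i t + (if tgt e = t then 1 else 0)) \<and>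
     e < k + n \<and> tight u p e \<and> src e \<le> i \<and>
     (src e < i \<longrightarrow> 0 < vt (tgt (f (src e))) \<and>
        (\<forall>t\<le>m. 0 < vt t \<and> vt t \<le> vt (tgt (f (src e))) \<longrightarrow> discovered i f u p vt pv t))"

text \<open>The degree of the free end of the path is raised in advance, which
  \<open>flipping\<close> balances by counting the edge not yet inserted. Inner nodes of the path
  lose one edge and gain one, so no other degree changes.\<close>

lemma flipping_init:
  assumes tree: "tree i f u p dg vs vt pv c" and i: "i < n"
    and e: "frontier vs vt e" "tight u p e" and t: "dg (tgt e) < cap (tgt e)"
  shows "flipping i f u p (dg(tgt e := Suc (dg (tgt e)))) vt pv e"
proof -
  have "src e < n" "vs (src e) \<noteq> 0" "e < k + n"
    using e(1) src_less by (auto simp: frontier_def)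
  then have "src e \<le> i \<and> (src e < i \<longrightarrow> 0 < vt (tgt (f (src e))))"
    using tree by (auto simp: tree_def tree_nodes_def)
  then show ?thesis
    using tree e t \<open>e < k + n\<close> unfolding flipping_def tree_def optimal_on_def slackness_def
    by force
qed

text \<open>The source of \<open>e\<close> gives up its old edge, and the target of that edge is
  compensated through its edge of discovery \<open>e'\<close>. The strictly smaller time of
  discovery serves as the variant of the loop.\<close>

lemma flipping_step:
  assumes fl: "flipping i f u p dg vt pv e" and s: "src e < i"
  defines "f' \<equiv> f(src e := e)" and "e' \<equiv> pv (tgt (f (src e)))"
  shows "flipping i f' u p dg vt pv e'"
    and "src e' < i \<Longrightarrow> vt (tgt (f' (src e'))) < vt (tgt (f (src e)))"
proof -
  let ?s = "src e" and ?t = "tgt (f (src e))"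
  have tm: "?t \<le> m"
    using fl s tgt_le by (auto simp: flipping_def tight_on_def)
  have disc: "discovered i f u p vt pv t" if "t \<le> m" "0 < vt t" "vt t \<le> vt ?t" for t
    using fl s that by (auto simp: flipping_def)
  have pos: "0 < vt ?t" using fl s by (simp add: flipping_def)
  have e': "e' < k + n" "tgt e' = ?t" "tight u p e'" "src e' \<le> i"
    "src e' < i \<Longrightarrow> 0 < vt (tgt (f (src e'))) \<and> vt (tgt (f (src e'))) < vt ?t"
    using disc[OF tm pos] by (auto simp: discovered_def e'_def)
  \<comment> \<open>Equal sources of \<open>e\<close> and \<open>e'\<close> would make a time of
    discovery smaller than itself.\<close>
  have f': "f' (src e') = f (src e')" if "src e' < i"
    using e'(5)[OF that] by (auto simp: f'_def)
  then show "vt (tgt (f' (src e'))) < vt ?t" if "src e' < i"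
    using e'(5) that by simp
  have "discovered i f' u p vt pv t"
    if "src e' < i" "t \<le> m" "0 < vt t" "vt t \<le> vt (tgt (f' (src e')))" for t
  proof -
    have less: "vt t < vt ?t" using that e'(5) f' by simp
    then have d: "discovered i f u p vt pv t" using disc that by simp
    then have "src (pv t) < i \<Longrightarrow> f' (src (pv t)) = f (src (pv t))"
      using less by (auto simp: discovered_def f'_def)
    then show ?thesis using d by (simp add: discovered_def)
  qed
  moreover have "load tgt f i t + (if tgt e = t then 1 else 0) =
      load tgt f' i t + (if tgt e' = t then 1 else 0)" for t
    using load_update[OF s, of tgt f e t] e'(2) by (simp add: f'_def)
  moreover have "tight_on i f' u p"
    using fl by (auto simp: flipping_def tight_on_def f'_def)
  ultimately show "flipping i f' u p dg vt pv e'"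
    using fl e' f' unfolding flipping_def by auto
qed

lemma flipping_final:
  assumes "flipping i f u p dg vt pv e" "\<not> src e < i"
  shows "optimal_on (Suc i) (f(i := e)) u p dg"
  using assms unfolding flipping_def optimal_on_def load_extend tight_on_def
  by (auto simp: less_Suc_eq)

end

section \<open>Orderings with spread classes\<close>

lemma nth_block:
  assumes "a < length (A @ C @ D)" and "P ((A @ C @ D) ! a)"
    and "\<forall>x \<in> set A \<union> set D. \<not> P x"
  shows "length A \<le> a" and "a < length A + length C"
proof -
  show "length A \<le> a"
  proof (rule ccontr)
    assume "\<not> length A \<le> a"
    then have "(A @ C @ D) ! a \<in> set A" by (simp add: nth_append)
    then show False using assms(2,3) by blast
  qed
  show "a < length A + length C"
  proof (rule ccontr)
    assume "\<not> a < length A + length C"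
    then have "(A @ C @ D) ! a \<in> set D" using assms(1) by (auto simp: nth_append)
    then show False using assms(2,3) by blast
  qed
qed

definition fibre :: "nat \<Rightarrow> (nat \<Rightarrow> nat) \<Rightarrow> nat \<Rightarrow> nat list" where
  "fibre n g t = filter (\<lambda>s. g s = t) [0..<n]"

definition blocks :: "nat \<Rightarrow> (nat \<Rightarrow> nat) \<Rightarrow> (nat \<Rightarrow> bool) \<Rightarrow> nat \<Rightarrow> nat list" where
  "blocks n g P m = concat (map (\<lambda>t. if P t then fibre n g t else []) [0..<m])"

lemma set_fibre: "set (fibre n g t) = {s. s < n \<and> g s = t}"
  by (auto simp: fibre_def)

lemma length_fibre: "length (fibre n g t) = card {s. s < n \<and> g s = t}"
  using distinct_card[of "fibre n g t"] by (simp add: set_fibre) (simp add: fibre_def)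

lemma set_blocks: "set (blocks n g P m) = {s. s < n \<and> g s < m \<and> P (g s)}"
  by (auto simp: blocks_def set_fibre split: if_splits)

lemma blocks_Suc: "blocks n g P (Suc m) = blocks n g P m @ (if P m then fibre n g m else [])"
  by (simp add: blocks_def)

lemma distinct_blocks: "distinct (blocks n g P m)"
proof (induction m)
  case (Suc m)
  then show ?case by (auto simp: blocks_Suc set_blocks set_fibre) (simp add: fibre_def)
qed (simp add: blocks_def)

lemma blocks_split:
  assumes "t < m" "P t"
  obtains D where "blocks n g P m = blocks n g P t @ fibre n g t @ D" "\<forall>s \<in> set D. g s \<noteq> t"
proof
  have "[0..<m] = [0..<t] @ t # [Suc t..<m]"
    using assms(1) upt_add_eq_append[of 0 t "m - t"] upt_conv_Cons[of t m] by simp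
  then show "blocks n g P m = blocks n g P t @ fibre n g t @
      concat (map (\<lambda>t. if P t then fibre n g t else []) [Suc t..<m])"
    using assms(2) by (simp add: blocks_def)
qed (auto simp: set_fibre split: if_splits)

text \<open>Saturated classes have exactly \<open>b\<close> elements, so each of them starts at the
  beginning of a row.\<close>

lemma dvd_length_blocks:
  assumes "\<And>t. t < m \<Longrightarrow> P t \<Longrightarrow> card {s. s < n \<and> g s = t} = b"
  shows "b dvd length (blocks n g P m)"
  using assms by (induction m) (auto simp: blocks_Suc length_fibre blocks_def)

text \<open>\<open>g\<close> maps a node to its partner, with \<open>m\<close> standing for being
  unmatched, and \<open>P\<close> marks the saturated partners. The class of \<open>m\<close> may
  have any size, as it is subject to no distance condition.\<close>

locale capacity =
  fixes n m b :: nat and g :: "nat \<Rightarrow> nat" and P :: "nat \<Rightarrow> bool"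
  assumes g_le: "s < n \<Longrightarrow> g s \<le> m"
    and full: "t < m \<Longrightarrow> P t \<Longrightarrow> card {s. s < n \<and> g s = t} = b"
    and not_full: "t < m \<Longrightarrow> \<not> P t \<Longrightarrow> card {s. s < n \<and> g s = t} < b"
    and spare: "\<not> P m"
    and b_pos: "0 < b"
begin

definition arrangement :: "nat list" where
  "arrangement = blocks n g P (Suc m) @ blocks n g (\<lambda>t. \<not> P t) (Suc m)"

lemma distinct_arrangement: "distinct arrangement"
  by (auto simp: arrangement_def distinct_blocks set_blocks)

lemma set_arrangement: "set arrangement = {..<n}"
  using g_le by (auto simp: arrangement_def set_blocks less_Suc_eq_le)

lemma length_arrangement: "length arrangement = n"
  using distinct_card[OF distinct_arrangement] by (simp add: set_arrangement)

text \<open>A saturated class fills a row of the array with \<open>b\<close> columns, the others have at most \<open>b - 1\<close>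
  elements.\<close>

lemma arrangement_close:
  assumes "a < a'" "a' < n" "g (arrangement ! a) = g (arrangement ! a')" "g (arrangement ! a) \<noteq> m"
  shows "a div b = a' div b \<or> a' + 2 \<le> a + b"
proof -
  define t where "t = g (arrangement ! a)"
  have "arrangement ! a \<in> set arrangement"
    using assms by (simp add: length_arrangement)
  then have t: "t < m" using assms(4) g_le unfolding t_def set_arrangement by (auto simp: le_less)
  show ?thesis
  proof (cases "P t")
    case True
    then obtain D where D: "blocks n g P (Suc m) = blocks n g P t @ fibre n g t @ D"
      "\<forall>s \<in> set D. g s \<noteq> t" using t blocks_split[of t "Suc m" P n g] by auto
    let ?D = "D @ blocks n g (\<lambda>t. \<not> P t) (Suc m)"
    have arr: "arrangement = blocks n g P t @ fibre n g t @ ?D"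
      by (simp add: arrangement_def D)
    have no: "\<forall>s \<in> set (blocks n g P t) \<union> set ?D. \<not> g s = t"
      using D(2) True by (auto simp: set_blocks)
    have len: "length (fibre n g t) = b" using full t True by (simp add: length_fibre)
    obtain q where q: "length (blocks n g P t) = b * q"
      using dvd_length_blocks[of t P n g b] full t by (meson dvdE less_trans)
    have "b * q \<le> x \<and> x < b * q + b" if "x < n" "g (arrangement ! x) = t" for x
      using nth_block[of x "blocks n g P t" "fibre n g t" ?D "\<lambda>s. g s = t"] that no len q
      by (simp add: arr[symmetric] length_arrangement)
    then have "x div b = q" if "x < n" "g (arrangement ! x) = t" for x
      using that by (intro div_nat_eqI) (auto simp: algebra_simps)
    then show ?thesis using assms t_def by simp
  next
    case False
    then obtain D where D: "blocks n g (\<lambda>t. \<not> P t) (Suc m) =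
        blocks n g (\<lambda>t. \<not> P t) t @ fibre n g t @ D"
      "\<forall>s \<in> set D. g s \<noteq> t" using t blocks_split[of t "Suc m" "\<lambda>t. \<not> P t" n g] by auto
    let ?A = "blocks n g P (Suc m) @ blocks n g (\<lambda>t. \<not> P t) t"
    have arr: "arrangement = ?A @ fibre n g t @ D"
      by (simp add: arrangement_def D)
    have no: "\<forall>s \<in> set ?A \<union> set D. \<not> g s = t"
      using D(2) False by (auto simp: set_blocks)
    have "length (fibre n g t) < b" using not_full t False by (simp add: length_fibre)
    moreover have "length ?A \<le> x \<and> x < length ?A + length (fibre n g t)"
      if "x < n" "g (arrangement ! x) = t" for x
      using nth_block[of x ?A "fibre n g t" D "\<lambda>s. g s = t"] that no
      unfolding arr[symmetric] length_arrangement by blast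
    from this[of a] this[of a'] have "length ?A \<le> a" "a' < length ?A + length (fibre n g t)"
      using assms t_def by auto
    ultimately show ?thesis by linarith
  qed
qed

end

text \<open>\<open>columns n b k\<close> lists the positions of a list of length \<open>n\<close>, written row by row into an array with \<open>b\<close>
  columns, in the first \<open>k\<close> columns; \<open>column n b r\<close> is the height of column \<open>r\<close>.\<close>

definition column :: "nat \<Rightarrow> nat \<Rightarrow> nat \<Rightarrow> nat" where
  "column n b r = (LEAST c. n \<le> r + c * b)"

definition columns :: "nat \<Rightarrow> nat \<Rightarrow> nat \<Rightarrow> nat list" where
  "columns n b k = concat (map (\<lambda>r. map (\<lambda>c. r + c * b) [0..<column n b r]) [0..<k])"

text \<open>The entries of column \<open>r\<close> are the positions \<open>r + c * b\<close> below
  \<open>n\<close>. As \<open>b > 0\<close>, the value \<open>c = n\<close> shows that the least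
  \<open>c\<close> in \<open>column\<close> exists.\<close>

lemma column_iff:
  assumes "0 < b"
  shows "c < column n b r \<longleftrightarrow> r + c * b < n"
proof -
  have "n \<le> n * b" using assms by (cases b) auto
  then have "n \<le> r + n * b" by linarith
  then have "n \<le> r + column n b r * b"
    unfolding column_def by (rule LeastI)
  moreover have "column n b r * b \<le> c * b" if "\<not> c < column n b r"
    using that by simp
  moreover have "\<not> n \<le> r + c * b" if "c < column n b r"
    using that unfolding column_def by (rule not_less_Least)
  ultimately show ?thesis by linarith
qed

lemma columns_Suc:
  "columns n b (Suc k) = columns n b k @ map (\<lambda>c. k + c * b) [0..<column n b k]"
  by (simp add: columns_def)

lemma columns_0 [simp]: "columns n b 0 = []"
  by (simp add: columns_def)

lemma set_columns:
  assumes "0 < b" "k \<le> b"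
  shows "set (columns n b k) = {j. j < n \<and> j mod b < k}"
  using assms(2)
proof (induction k)
  case (Suc k)
  have "j \<in> (\<lambda>c. k + c * b) ` {0..<column n b k}" if "j mod b = k" "j < n" for j
    using that mod_div_mult_eq[of j b] assms(1)
    by (intro image_eqI[of _ _ "j div b"]) (auto simp: column_iff)
  then have "(\<lambda>c. k + c * b) ` {0..<column n b k} = {j. j < n \<and> j mod b = k}"
    using Suc.prems assms(1) by (auto simp: column_iff)
  then show ?case using Suc by (auto simp: columns_Suc less_Suc_eq)
qed simp

lemma distinct_columns:
  assumes "0 < b" "k \<le> b"
  shows "distinct (columns n b k)"
  using assms(2)
proof (induction k)
  case (Suc k)
  then show ?case
    using assms by (auto simp: columns_Suc set_columns distinct_map inj_on_def)
qed simp

lemma length_columns: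
  assumes "0 < b"
  shows "length (columns n b b) = n"
proof -
  have "set (columns n b b) = {..<n}" using assms by (auto simp: set_columns)
  then show ?thesis using distinct_card[OF distinct_columns[of b b n]] assms by simp
qed

lemma length_columns_diff:
  assumes "b * d \<le> n" "k \<le> k'" "k' \<le> b"
  shows "length (columns n b k) + (k' - k) * d \<le> length (columns n b k')"
  using assms(2,3)
proof (induction k' rule: dec_induct)
  case (step k')
  have "d \<le> column n b k'"
  proof (cases d)
    case (Suc c)
    \<comment> \<open>With \<open>d = Suc c\<close>, the \<open>d\<close>-th entry of the column is
      \<open>k' + c * b\<close>, and \<open>k' < b\<close> gives
      \<open>k' + c * b < d * b \<le> n\<close>.\<close>
    then have "k' + c * b < n" using step.prems assms(1) by (simp add: mult.commute)
    then show ?thesis using Suc column_iff[of b c n k'] step by auto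
  qed simp
  then show ?case using step by (simp add: columns_Suc Suc_diff_le)
qed simp

text \<open>Inverts the reading order: the entry in row \<open>c\<close> and column \<open>r\<close>
  comes after all earlier columns and \<open>c\<close> entries of its own. Distinctness makes this
  its only position.\<close>

lemma columns_nth:
  assumes b: "0 < b" and i: "i < n"
  shows "columns n b b ! i < n"
    and "i = length (columns n b (columns n b b ! i mod b)) + columns n b b ! i div b"
proof -
  let ?j = "columns n b b ! i"
  have "?j \<in> set (columns n b b)" using i length_columns[OF b] by simp
  then show j: "?j < n" using b by (simp add: set_columns)
  let ?r = "?j mod b" and ?c = "?j div b"
  have r: "?r < b" using b by simp
  have split: "\<exists>D. columns n b k' = columns n b k @ D" if "k \<le> k'" for k k'
    using that by (induction k' rule: dec_induct) (auto simp: columns_Suc)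
  obtain D where D: "columns n b b = columns n b ?r @ map (\<lambda>c. ?r + c * b) [0..<column n b ?r] @ D"
    using split[of "Suc ?r" b] r by (auto simp: columns_Suc)
  have c: "?c < column n b ?r" using b j by (simp add: column_iff)
  let ?i = "length (columns n b ?r) + ?c"
  have "columns n b b ! ?i = ?j"
    using c unfolding arg_cong[OF D, of "\<lambda>xs. xs ! ?i"] by (simp add: nth_append)
  moreover have "?i < n"
    using c arg_cong[OF D, of length] length_columns[OF b] by simp
  ultimately show "i = ?i"
    using distinct_columns[OF b order_refl, of n] i length_columns[OF b, of n]
      nth_eq_iff_index_eq[OF distinct_columns[OF b order_refl, of n], of i ?i] by simp
qed

text \<open>Each column has at least \<open>d\<close> elements, so elements in columns \<open>r\<close> and \<open>r'\<close> are about
  \<open>d * (r' - r)\<close> apart.\<close>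

lemma columns_spread:
  assumes b: "0 < b" "b * d \<le> n" and d: "1 \<le> d" and i: "i < n" "i' < n"
    and j: "j = columns n b b ! i" "j' = columns n b b ! i'" "j < j'"
      "j div b = j' div b \<or> j' + 2 \<le> j + b"
  shows "int d \<le> \<bar>int i - int i'\<bar> \<and> \<bar>int i - int i'\<bar> \<le> int n - int d"
proof -
  let ?P = "\<lambda>k. length (columns n b k)"
  define r r' c c' where rc: "r = j mod b" "r' = j' mod b" "c = j div b" "c' = j' div b"
  have pos: "i = ?P r + c" "i' = ?P r' + c'"
    using columns_nth(2)[OF b(1)] i j(1,2) by (auto simp: rc)
  have jrc: "j = c * b + r" "j' = c' * b + r'" by (auto simp: rc)
  have r: "r < b" "r' < b" using b by (auto simp: rc)
  \<comment> \<open>At least \<open>d\<close> positions lie from the start of any column to the end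
    of the list; this yields the cyclic bound \<open>n - d\<close>.\<close>
  have ends: "?P k + d \<le> n" if "k < b" for k
    using length_columns_diff[OF b(2), of k b] that length_columns[OF b(1), of n]
      mult_le_mono1[of 1 "b - k" d] by linarith
  have diff: "?P k + d \<le> ?P k'" if "k < k'" "k' < b" for k k'
    using length_columns_diff[OF b(2), of k k'] that mult_le_mono1[of 1 "k' - k" d] by linarith
  have diff2: "?P k + 2 * d \<le> ?P k'" if "k + 2 \<le> k'" "k' < b" for k k'
    using length_columns_diff[OF b(2), of k k'] that mult_le_mono1[of 2 "k' - k" d] by linarith
  show ?thesis
  proof (cases "c = c'")
    case True
    then have "r < r'" using jrc j(3) by simp
    then show ?thesis using diff[of r r'] ends[of r'] r True pos by simp
  next
    case False
    then have near: "j' + 2 \<le> j + b" using j(4) rc by simp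
    have "c \<le> c'" using j(3) by (simp add: rc div_le_mono)
    moreover have "c' \<le> Suc c"
    proof (rule ccontr)
      assume "\<not> c' \<le> Suc c"
      then have "(c + 2) * b \<le> c' * b" by (intro mult_right_mono) auto
      then show False using near jrc r by simp
    qed
    ultimately have c': "c' = Suc c" using False by simp
    \<comment> \<open>The second entry lies one row down and at least two columns to the left. The
      extra row costs one position, and \<open>2 * d - 1 \<ge> d\<close> since
      \<open>d \<ge> 1\<close>.\<close>
    then have "r' + 2 \<le> r" using near jrc by simp
    then show ?thesis using diff2[of r' r] ends[of r] r c' pos d by simp
  qed
qed

section \<open>Spread sets of positions on a cycle\<close>

lemma card_spread:
  fixes A :: "nat set"
  assumes "finite A" "A \<noteq> {}"
    and "\<And>i j. i \<in> A \<Longrightarrow> j \<in> A \<Longrightarrow> i < j \<Longrightarrow> i + d \<le> j"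
  shows "Min A + (card A - 1) * d \<le> Max A"
  using assms
proof (induction "card A" arbitrary: A)
  case (Suc N)
  show ?case
  proof (cases "A = {Max A}")
    case True
    then have "card A = card {Max A}" by (rule arg_cong)
    then show ?thesis using Suc.prems by simp
  next
    case False
    let ?A = "A - {Max A}"
    have ne: "?A \<noteq> {}" and mem: "Max A \<in> A" using False Suc.prems by auto
    have card: "card ?A = card A - 1" using Suc.prems mem by simp
    have "card ?A \<noteq> 0" using ne Suc.prems(1) by (metis card_0_eq finite_Diff)
    have IH: "Min ?A + (card ?A - 1) * d \<le> Max ?A"
      using Suc.prems Suc.hyps(2) ne card by (intro Suc.hyps(1)) auto
    have "Max ?A \<in> ?A" using ne Suc.prems by (intro Max_in) auto
    then have "Max ?A + d \<le> Max A"
      using Suc.prems by (metis DiffE Max_ge insertI1 le_neq_implies_less mem)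
    moreover have "Min A \<le> Min ?A" using Suc.prems ne by (intro Min_antimono) auto
    moreover have "card A - 1 = Suc (card ?A - 1)"
      using card \<open>card ?A \<noteq> 0\<close> by linarith
    then have "(card A - 1) * d = (card ?A - 1) * d + d" by simp
    ultimately show ?thesis using IH by linarith
  qed
qed simp

text \<open>There are \<open>card A - 1\<close> gaps between the least and the greatest element, and
  the cyclic condition on these two provides one more gap around the end. A single element would not
  provide this last gap, whence \<open>2 \<le> card A\<close>.\<close>

lemma card_spread_cyclic:
  fixes A :: "nat set"
  assumes "A \<subseteq> {..<n}" "2 \<le> card A"
    and spread: "\<And>i j. i \<in> A \<Longrightarrow> j \<in> A \<Longrightarrow> i \<noteq> j \<Longrightarrow>
      int d \<le> \<bar>int i - int j\<bar> \<and> \<bar>int i - int j\<bar> \<le> int n - int d"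
  shows "card A * d \<le> n"
proof -
  have fin: "finite A" "A \<noteq> {}" using assms(1,2) finite_subset[of A "{..<n}"] by auto
  have "Min A + (card A - 1) * d \<le> Max A"
  proof (rule card_spread[OF fin])
    fix i j assume "i \<in> A" "j \<in> A" "i < j"
    then show "i + d \<le> j" using spread[of i j] by simp
  qed
  moreover have "Min A \<noteq> Max A"
  proof
    assume "Min A = Max A"
    then have "A \<subseteq> {Max A}"
      using fin by (metis Max_ge Min_le antisym insertI1 subsetI)
    then show False using card_mono[of "{Max A}" A] assms(2) by simp
  qed
  then have "Max A + d \<le> Min A + n"
    using spread[of "Max A" "Min A"] fin by auto
  ultimately have "(card A - 1) * d + d \<le> n" by linarith
  then show ?thesis using assms(2) by (cases "card A") auto
qed

section \<open>The program\<close>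

abbreviation slack_exp :: "nexp \<Rightarrow> rexp" where
  "slack_exp e \<equiv> RSub (RAdd (RRead ''u'' (NRead ''source'' e)) (RRead ''p'' (NRead ''target'' e)))
     (RRead ''weight'' e)"

text \<open>Equality has to be composed from two order tests; the programs use it negated, with the
  action in the second branch.\<close>

abbreviation neq :: "nexp \<Rightarrow> nexp \<Rightarrow> bexp" where
  "neq a b \<equiv> BNot (BAnd (BNot (NLess a b)) (BNot (NLess b a)))"

text \<open>The arrays \<open>f\<close>, \<open>u\<close>, \<open>p\<close>, \<open>vs\<close>, \<open>vt\<close>, \<open>pv\<close> and the counter \<open>c\<close> hold the arguments of
  \<open>tree\<close> with these names, \<open>deg\<close> holds \<open>dg\<close>, and the root \<open>i\<close> is the loop counter of \<open>solve\<close>. The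
  array \<open>l\<close> receives the nodes class by class; \<open>h\<close> is the length of the list being written.\<close>

definition quotient :: com where
  "quotient = (put ''b'' (NConst 0) ;; put ''x'' (get ''d'') ;;
    While (BNot (NLess (get ''n'') (get ''x'')))
      (put ''b'' (NAdd (get ''b'') (NConst 1)) ;; put ''x'' (NAdd (get ''x'') (get ''d''))) ;;
    If (NLess (get ''b'') (NConst 1)) (put ''b'' (NConst 1)) Skip)"

text \<open>The weights are nonnegative, so their sum \<open>U\<close> dominates each of them; as
  initial value of all \<open>u\<close> it makes zero prices feasible.\<close>

definition extend :: com where
  "extend = (put ''K'' (NAdd (get ''k'') (get ''n'')) ;; put ''M'' (NAdd (get ''m'') (NConst 1)) ;;
    For ''s'' ''n'' (NWrite ''source'' (NAdd (get ''k'') (get ''s'')) (get ''s'') ;;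
      NWrite ''target'' (NAdd (get ''k'') (get ''s'')) (get ''m'')) ;;
    For ''t'' ''m'' (NWrite ''cap'' (get ''t'') (get ''b'')) ;;
    NWrite ''cap'' (get ''m'') (NAdd (get ''n'') (NConst 1)) ;;
    For ''e'' ''k'' (RWrite ''U'' (NConst 0)
      (RAdd (RRead ''U'' (NConst 0)) (RRead ''weight'' (get ''e'')))) ;;
    For ''s'' ''n'' (RWrite ''u'' (get ''s'') (RRead ''U'' (NConst 0))))"

text \<open>\<open>pv\<close> keeps entries from earlier searches; they are read only at nodes with
  nonzero \<open>vt\<close>.\<close>

definition reset :: com where
  "reset = (For ''s'' ''n'' (NWrite ''vs'' (get ''s'') (NConst 0)) ;;
    For ''t'' ''M'' (NWrite ''vt'' (get ''t'') (NConst 0)) ;;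
    NWrite ''vs'' (get ''i'') (NConst 1) ;; put ''c'' (NConst 0))"

definition scan :: com where
  "scan = (put ''best'' (NAdd (get ''k'') (get ''i'')) ;;
    For ''e'' ''K''
      (If (BAnd (NLess (NConst 0) (NRead ''vs'' (NRead ''source'' (get ''e''))))
                (NLess (NRead ''vt'' (NRead ''target'' (get ''e''))) (NConst 1)))
        (If (RLess (slack_exp (get ''e'')) (slack_exp (get ''best''))) (put ''best'' (get ''e'')) Skip)
        Skip))"

definition reprice :: com where
  "reprice = (RWrite ''D'' (NConst 0) (slack_exp (get ''best'')) ;;
    For ''s'' ''n'' (If (NLess (NConst 0) (NRead ''vs'' (get ''s'')))
      (RWrite ''u'' (get ''s'') (RSub (RRead ''u'' (get ''s'')) (RRead ''D'' (NConst 0)))) Skip) ;;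
    For ''t'' ''M'' (If (NLess (NConst 0) (NRead ''vt'' (get ''t'')))
      (RWrite ''p'' (get ''t'') (RAdd (RRead ''p'' (get ''t'')) (RRead ''D'' (NConst 0)))) Skip))"

definition grow :: com where
  "grow = (put ''c'' (NAdd (get ''c'') (NConst 1)) ;;
    NWrite ''vt'' (NRead ''target'' (get ''best'')) (get ''c'') ;;
    NWrite ''pv'' (NRead ''target'' (get ''best'')) (get ''best'') ;;
    For ''s'' ''i'' (If (neq (NRead ''target'' (NRead ''f'' (get ''s''))) (NRead ''target'' (get ''best'')))
      Skip (NWrite ''vs'' (get ''s'') (NConst 1))))"

text \<open>Repricing takes place in every round, with amount 0 if a tight frontier edge exists;
  afterwards the chosen edge is tight in any case.\<close>

definition search :: com where
  "search = (put ''done'' (NConst 0) ;;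
    While (NLess (get ''done'') (NConst 1)) (scan ;; reprice ;;
      If (NLess (NRead ''deg'' (NRead ''target'' (get ''best'')))
                (NRead ''cap'' (NRead ''target'' (get ''best''))))
        (put ''done'' (NConst 1)) grow))"

definition flip :: com where
  "flip = (NWrite ''deg'' (NRead ''target'' (get ''best''))
      (NAdd (NRead ''deg'' (NRead ''target'' (get ''best''))) (NConst 1)) ;;
    put ''cur'' (get ''best'') ;;
    While (NLess (NRead ''source'' (get ''cur'')) (get ''i''))
      (put ''o'' (NRead ''f'' (NRead ''source'' (get ''cur''))) ;;
       NWrite ''f'' (NRead ''source'' (get ''cur'')) (get ''cur'') ;;
       put ''cur'' (NRead ''pv'' (NRead ''target'' (get ''o'')))) ;;
    NWrite ''f'' (get ''i'') (get ''cur''))"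

definition solve :: com where
  "solve = For ''i'' ''n'' (reset ;; search ;; flip)"

definition collect :: com where
  "collect = For ''s'' ''n'' (If (neq (NRead ''target'' (NRead ''f'' (get ''s''))) (get ''t'')) Skip
    (NWrite ''l'' (get ''h'') (get ''s'') ;; put ''h'' (NAdd (get ''h'') (NConst 1))))"

definition arrange :: com where
  "arrange = (put ''h'' (NConst 0) ;;
    For ''t'' ''M'' (If (NLess (NRead ''deg'' (get ''t'')) (NRead ''cap'' (get ''t''))) Skip collect) ;;
    For ''t'' ''M'' (If (NLess (NRead ''deg'' (get ''t'')) (NRead ''cap'' (get ''t''))) collect Skip))"

definition transpose :: com where
  "transpose = (put ''h'' (NConst 0) ;;
    For ''r'' ''b'' (put ''j'' (get ''r'') ;;
      While (NLess (get ''j'') (get ''n''))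
        (NWrite ''order'' (get ''h'') (NRead ''l'' (get ''j'')) ;;
         put ''h'' (NAdd (get ''h'') (NConst 1)) ;;
         put ''j'' (NAdd (get ''j'') (get ''b'')))))"

definition mark :: com where
  "mark = For ''s'' ''n'' (NWrite ''matching'' (NRead ''f'' (get ''s'')) (NConst 1))"

definition algorithm :: com where
  "algorithm = (quotient ;; extend ;; solve ;; arrange ;; transpose ;; mark)"

section \<open>Verification of the program\<close>

lemma wp_quotient:
  assumes "nmem \<mu> ''n'' 0 = n" "nmem \<mu> ''d'' 0 = d" "1 \<le> d" "n \<le> B"
  shows "wp B quotient (\<lambda>\<mu>'. nmem \<mu>' ''b'' 0 = max 1 (n div d)) \<mu>"
  unfolding quotient_def
proof (intro wp_Seq wp_NWrite, rule wp_While[where V = "\<lambda>\<mu>. n - nmem \<mu> ''b'' 0" and I =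
      "\<lambda>\<mu>. nmem \<mu> ''x'' 0 = (nmem \<mu> ''b'' 0 + 1) * d \<and> nmem \<mu> ''b'' 0 * d \<le> n"], goal_cases)
  \<comment> \<open>Cases 3 and 4 are the step and the exit premise of \<open>wp_While\<close>. The
    value of \<open>x\<close> is one multiple of \<open>d\<close> ahead of \<open>b\<close>, and
    \<open>d \<ge> 1\<close> keeps \<open>b\<close> at most \<open>n\<close>, so there are at most
    \<open>n\<close> rounds.\<close>
  case (3 \<mu>')
  then have "(nmem \<mu>' ''b'' 0 + 1) * d \<le> n" using assms by (simp add: frame_def)
  moreover have "nmem \<mu>' ''b'' 0 + 1 \<le> (nmem \<mu>' ''b'' 0 + 1) * d"
    using mult_le_mono2[OF assms(3), of "nmem \<mu>' ''b'' 0 + 1"] by simp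
  ultimately show ?case
    using 3 assms by (intro wp_Seq wp_NWrite) (auto simp: frame_def)
next
  case (4 \<mu>')
  then have "nmem \<mu>' ''b'' 0 = n div d"
    using assms by (intro div_nat_eqI[symmetric]) (auto simp: frame_def algebra_simps)
  then show ?case by (intro wp_If wp_NWrite wp_Skip) auto
qed (use assms in auto)

lemma wp_extend:
  assumes sz: "nmem \<mu> ''n'' 0 = n" "nmem \<mu> ''m'' 0 = m" "nmem \<mu> ''k'' 0 = k" "nmem \<mu> ''b'' 0 = b"
    and U: "rmem \<mu> ''U'' 0 = 0" and B: "n \<le> B" "m \<le> B" "k \<le> B"
  shows "wp B extend (\<lambda>\<mu>'. nmem \<mu>' ''K'' 0 = k + n \<and> nmem \<mu>' ''M'' 0 = Suc m \<and>
     nmem \<mu>' ''source'' = (\<lambda>e. if k \<le> e \<and> e < k + n then e - k else nmem \<mu> ''source'' e) \<and>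
     nmem \<mu>' ''target'' = (\<lambda>e. if k \<le> e \<and> e < k + n then m else nmem \<mu> ''target'' e) \<and>
     (\<forall>t<m. nmem \<mu>' ''cap'' t = b) \<and> nmem \<mu>' ''cap'' m = Suc n \<and>
     (\<forall>s<n. rmem \<mu>' ''u'' s = (\<Sum>e<k. rmem \<mu> ''weight'' e))) \<mu>"
  unfolding extend_def
proof (intro wp_Seq wp_NWrite, rule wp_For[where H = n and I = "\<lambda>j \<mu>'.
     nmem \<mu>' ''source'' = (\<lambda>e. if k \<le> e \<and> e < k + j then e - k else nmem \<mu> ''source'' e) \<and>
     nmem \<mu>' ''target'' = (\<lambda>e. if k \<le> e \<and> e < k + j then m else nmem \<mu> ''target'' e)"], goal_cases)
  \<comment> \<open>Cases 7 and 8 of \<open>wp_For\<close> are its step and its exit premise; what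
    follows a loop is verified inside the latter.\<close>
  case (7 j \<mu>')
  then have mem: "nmem \<mu>' ''k'' 0 = k" "nmem \<mu>' ''m'' 0 = m" by (simp_all add: frame_def sz)
  from 7(2-4) show ?case
    by (intro wp_Seq wp_NWrite) (auto simp: mem fun_eq_iff)
next
  case (8 \<mu>1)
  then have mem1: "nmem \<mu>1 ''n'' 0 = n" "nmem \<mu>1 ''m'' 0 = m" "nmem \<mu>1 ''k'' 0 = k"
    "nmem \<mu>1 ''b'' 0 = b" "rmem \<mu>1 = rmem \<mu>" "nmem \<mu>1 ''K'' 0 = k + n" "nmem \<mu>1 ''M'' 0 = Suc m"
    by (simp_all add: frame_def sz fun_eq_iff)
  note st = 8(2)
  show ?case
  proof (intro wp_Seq, rule wp_For[where H = m and I = "\<lambda>j \<mu>'. \<forall>t<j. nmem \<mu>' ''cap'' t = b"], goal_cases)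
    case (7 j \<mu>')
    then have "nmem \<mu>' ''b'' 0 = b" by (simp add: frame_def mem1)
    with 7(2-4) show ?case by (intro wp_NWrite) (simp add: less_Suc_eq)
  next
    case (8 \<mu>2)
    then have mem2: "\<And>x. x \<notin> {''t'', ''cap''} \<Longrightarrow> nmem \<mu>2 x = nmem \<mu>1 x" "rmem \<mu>2 = rmem \<mu>"
      by (simp_all add: frame_def mem1 fun_eq_iff)
    note cap = 8(2)
    show ?case
    proof (intro wp_NWrite wp_Seq, rule wp_For[where H = k and
          I = "\<lambda>j \<mu>'. rmem \<mu>' ''U'' 0 = (\<Sum>e<j. rmem \<mu> ''weight'' e)"], goal_cases)
      case (7 j \<mu>')
      then have "rmem \<mu>' ''weight'' = rmem \<mu> ''weight''" by (simp add: frame_def mem2)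
      with 7(2-4) show ?case by (intro wp_RWrite) simp
    next
      case (8 \<mu>3)
      then have mem3: "\<And>x. x \<notin> {''t'', ''cap'', ''e''} \<Longrightarrow> nmem \<mu>3 x = nmem \<mu>1 x"
        "nmem \<mu>3 ''cap'' = (nmem \<mu>2 ''cap'')(m := Suc n)"
        by (simp_all add: frame_def mem1 mem2)
      note U = 8(2)
      show ?case
      proof (rule wp_For[where H = n and I = "\<lambda>j \<mu>'.
          \<forall>s<j. rmem \<mu>' ''u'' s = (\<Sum>e<k. rmem \<mu> ''weight'' e)"], goal_cases)
        case (7 j \<mu>')
        then have "rmem \<mu>' ''U'' = rmem \<mu>3 ''U''" by (simp add: frame_def)
        with 7(2-4) U show ?case by (intro wp_RWrite) (simp add: less_Suc_eq)
      next
        case (8 \<mu>')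
        then show ?case using st cap by (simp add: frame_def mem1 mem3)
      qed (simp_all add: mem1 mem3 B)
    qed (simp_all add: mem1 mem2 B U)
  qed (simp_all add: mem1 B)
qed (simp_all add: sz B fun_eq_iff)

context assignment
begin

text \<open>The part of memory that stays constant while \<open>solve\<close> runs. Whole arrays are
  equated with the functions of the locale, so that \<open>frame\<close> preserves the
  property.\<close>

definition instance_in :: "state \<Rightarrow> bool" where
  "instance_in \<mu> \<longleftrightarrow> nmem \<mu> ''n'' 0 = n \<and> nmem \<mu> ''m'' 0 = m \<and> nmem \<mu> ''k'' 0 = k \<and>
     nmem \<mu> ''K'' 0 = k + n \<and> nmem \<mu> ''M'' 0 = Suc m \<and>
     nmem \<mu> ''source'' = src \<and> nmem \<mu> ''target'' = tgt \<and> nmem \<mu> ''cap'' = cap \<and>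
     rmem \<mu> ''weight'' = wt"

lemma wp_reset:
  assumes inst: "instance_in \<mu>" and i: "nmem \<mu> ''i'' 0 = i" and B: "n \<le> B" "Suc m \<le> B"
  shows "wp B reset (\<lambda>\<mu>'. (\<forall>s<n. nmem \<mu>' ''vs'' s = (if s = i then 1 else 0)) \<and>
     (\<forall>t\<le>m. nmem \<mu>' ''vt'' t = 0) \<and> nmem \<mu>' ''c'' 0 = 0) \<mu>"
  unfolding reset_def
proof (intro wp_Seq, rule wp_For[where H = n and I = "\<lambda>j \<mu>'. \<forall>s<j. nmem \<mu>' ''vs'' s = 0"], goal_cases)
  case (7 j \<mu>')
  then show ?case by (intro wp_NWrite) (simp add: less_Suc_eq)
next
  case (8 \<mu>1)
  then have mem1: "nmem \<mu>1 ''M'' 0 = Suc m" "nmem \<mu>1 ''i'' 0 = i"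
    using inst i by (simp_all add: frame_def instance_in_def)
  note vs = 8(2)
  show ?case
  proof (intro wp_Seq, rule wp_For[where H = "Suc m" and I = "\<lambda>j \<mu>'. \<forall>t<j. nmem \<mu>' ''vt'' t = 0"],
      goal_cases)
    case (7 j \<mu>')
    then show ?case by (intro wp_NWrite) (simp add: less_Suc_eq)
  next
    case (8 \<mu>')
    then show ?case
      using vs by (intro wp_Seq wp_NWrite) (simp add: frame_def mem1 less_Suc_eq_le)
  qed (simp_all add: mem1 B)
qed (use inst B in \<open>simp_all add: instance_in_def\<close>)

lemma wp_scan:
  assumes inst: "instance_in \<mu>" and i: "nmem \<mu> ''i'' 0 = i" and B: "k + n \<le> B"
    and vs: "nmem \<mu> ''vs'' = vs" and vt: "nmem \<mu> ''vt'' = vt"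
    and u: "rmem \<mu> ''u'' = u" and p: "rmem \<mu> ''p'' = p"
    and start: "frontier vs vt (k + i)"
  shows "wp B scan (\<lambda>\<mu>'. frontier vs vt (nmem \<mu>' ''best'' 0) \<and>
     (\<forall>e'. frontier vs vt e' \<longrightarrow> slack u p (nmem \<mu>' ''best'' 0) \<le> slack u p e')) \<mu>"
  unfolding scan_def
proof (intro wp_Seq wp_NWrite, rule wp_For[where H = "k + n" and
      I = "\<lambda>j \<mu>'. frontier vs vt (nmem \<mu>' ''best'' 0) \<and>
     (\<forall>e'<j. frontier vs vt e' \<longrightarrow> slack u p (nmem \<mu>' ''best'' 0) \<le> slack u p e')"], goal_cases)
  case (7 j \<mu>')
  have mem: "nmem \<mu>' ''vs'' = vs" "nmem \<mu>' ''vt'' = vt" "rmem \<mu>' ''u'' = u" "rmem \<mu>' ''p'' = p"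
    "nmem \<mu>' ''source'' = src" "nmem \<mu>' ''target'' = tgt" "rmem \<mu>' ''weight'' = wt"
    using 7(1) inst vs vt u p by (simp_all add: frame_def instance_in_def)
  have test: "0 < vs (src j) \<and> vt (tgt j) < 1 \<longleftrightarrow> frontier vs vt j"
    using 7(3) by (auto simp: frontier_def)
  show ?case
    using 7(2,4) test
    by (intro wp_If wp_Skip wp_NWrite) (auto simp: mem less_Suc_eq slack_def[symmetric] intro: less_imp_le order_trans)
qed (use inst i B start in \<open>auto simp: instance_in_def frontier_def\<close>)

lemma wp_reprice:
  assumes inst: "instance_in \<mu>" and B: "n \<le> B" "Suc m \<le> B"
    and vs: "nmem \<mu> ''vs'' = vs" and vt: "nmem \<mu> ''vt'' = vt"
    and u: "rmem \<mu> ''u'' = u" and p: "rmem \<mu> ''p'' = p"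
    and \<delta>: "\<delta> = slack u p (nmem \<mu> ''best'' 0)"
  shows "wp B reprice (\<lambda>\<mu>'. rmem \<mu>' ''u'' = lower vs \<delta> u \<and> rmem \<mu>' ''p'' = raise vt \<delta> p) \<mu>"
  unfolding reprice_def
proof (intro wp_Seq wp_RWrite, rule wp_For[where H = n and I = "\<lambda>j \<mu>'.
      rmem \<mu>' ''u'' = (\<lambda>s. if s < j \<and> vs s \<noteq> 0 then u s - \<delta> else u s)"], goal_cases)
  case (7 j \<mu>')
  then have "nmem \<mu>' ''vs'' = vs" "rmem \<mu>' ''D'' 0 = \<delta>"
    using inst by (simp_all add: frame_def instance_in_def vs \<delta> slack_def u p)
  with 7(2-4) show ?case
    by (intro wp_If wp_RWrite wp_Skip) (auto simp: less_Suc_eq fun_eq_iff)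
next
  case (8 \<mu>1)
  then have mem1: "nmem \<mu>1 ''M'' 0 = Suc m" "nmem \<mu>1 ''vt'' = vt" "rmem \<mu>1 ''p'' = p"
      "rmem \<mu>1 ''D'' 0 = \<delta>"
    using inst by (simp_all add: frame_def instance_in_def vt \<delta> slack_def u p)
  note u' = 8(2)
  show ?case
  proof (rule wp_For[where H = "Suc m" and I = "\<lambda>j \<mu>'.
        rmem \<mu>' ''p'' = (\<lambda>t. if t < j \<and> vt t \<noteq> 0 then p t + \<delta> else p t)"], goal_cases)
    case (7 j \<mu>')
    then have "nmem \<mu>' ''vt'' = vt" "rmem \<mu>' ''D'' 0 = \<delta>"
      by (simp_all add: frame_def mem1)
    with 7(2-4) show ?case
      by (intro wp_If wp_RWrite wp_Skip) (auto simp: less_Suc_eq fun_eq_iff)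
  next
    case (8 \<mu>')
    then show ?case
      using u' by (simp add: frame_def lower_def raise_def less_Suc_eq_le fun_eq_iff)
  qed (simp_all add: mem1 B)
qed (use inst B u in \<open>simp_all add: instance_in_def\<close>)

lemma wp_grow:
  assumes inst: "instance_in \<mu>" and i: "nmem \<mu> ''i'' 0 = i" "i \<le> B"
    and e: "nmem \<mu> ''best'' 0 = e" and c: "nmem \<mu> ''c'' 0 = c" and f: "nmem \<mu> ''f'' = f"
    and vs: "nmem \<mu> ''vs'' = vs" and vt: "nmem \<mu> ''vt'' = vt" and pv: "nmem \<mu> ''pv'' = pv"
  shows "wp B grow (\<lambda>\<mu>'. nmem \<mu>' ''c'' 0 = Suc c \<and>
     nmem \<mu>' ''vs'' = (\<lambda>s. if s < i \<and> tgt (f s) = tgt e then 1 else vs s) \<and>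
     nmem \<mu>' ''vt'' = vt(tgt e := Suc c) \<and> nmem \<mu>' ''pv'' = pv(tgt e := e)) \<mu>"
  unfolding grow_def
proof (intro wp_Seq wp_NWrite, rule wp_For[where H = i and I = "\<lambda>j \<mu>'.
    nmem \<mu>' ''vs'' = (\<lambda>s. if s < j \<and> tgt (f s) = tgt e then 1 else vs s)"], goal_cases)
  case (7 j \<mu>')
  then have "nmem \<mu>' ''f'' = f" "nmem \<mu>' ''best'' 0 = e" "nmem \<mu>' ''target'' = tgt"
    using inst by (simp_all add: frame_def instance_in_def e f)
  with 7(2-4) show ?case
    by (intro wp_If wp_NWrite wp_Skip) (auto simp: less_Suc_eq fun_eq_iff)
next
  case (8 \<mu>')
  then show ?case using inst by (simp add: frame_def instance_in_def c vt pv e)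
qed (use inst i vs in \<open>simp_all add: instance_in_def\<close>)

lemma wp_search:
  assumes inst: "instance_in \<mu>" and i: "nmem \<mu> ''i'' 0 = i" "i < n"
    and B: "k + n \<le> B" "m + 2 \<le> B" and f: "nmem \<mu> ''f'' = f" and dg: "nmem \<mu> ''deg'' = dg"
    and tree: "tree i f (rmem \<mu> ''u'') (rmem \<mu> ''p'') dg (nmem \<mu> ''vs'') (nmem \<mu> ''vt'') (nmem \<mu> ''pv'')
      (nmem \<mu> ''c'' 0)"
  shows "wp B search (\<lambda>\<mu>'.
    tree i f (rmem \<mu>' ''u'') (rmem \<mu>' ''p'') dg (nmem \<mu>' ''vs'') (nmem \<mu>' ''vt'') (nmem \<mu>' ''pv'')
      (nmem \<mu>' ''c'' 0) \<and>
    frontier (nmem \<mu>' ''vs'') (nmem \<mu>' ''vt'') (nmem \<mu>' ''best'' 0) \<and>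
    tight (rmem \<mu>' ''u'') (rmem \<mu>' ''p'') (nmem \<mu>' ''best'' 0) \<and>
    dg (tgt (nmem \<mu>' ''best'' 0)) < cap (tgt (nmem \<mu>' ''best'' 0))) \<mu>"
proof -
  let ?T = "\<lambda>\<mu>'. tree i f (rmem \<mu>' ''u'') (rmem \<mu>' ''p'') dg (nmem \<mu>' ''vs'') (nmem \<mu>' ''vt'')
    (nmem \<mu>' ''pv'') (nmem \<mu>' ''c'' 0)"
  let ?E = "\<lambda>\<mu>'. frontier (nmem \<mu>' ''vs'') (nmem \<mu>' ''vt'') (nmem \<mu>' ''best'' 0) \<and>
    tight (rmem \<mu>' ''u'') (rmem \<mu>' ''p'') (nmem \<mu>' ''best'' 0)"
  let ?Q = "\<lambda>\<mu>'. ?E \<mu>' \<and> dg (tgt (nmem \<mu>' ''best'' 0)) < cap (tgt (nmem \<mu>' ''best'' 0))"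
  \<comment> \<open>By \<open>tree_count_le\<close>, \<open>c \<le> m\<close> before every round. So
    the variant is at least 2 then, and both increasing \<open>c\<close> and setting
    \<open>done\<close> lower it.\<close>
  let ?V = "\<lambda>\<mu>'. if nmem \<mu>' ''done'' 0 = 0 then m + 2 - nmem \<mu>' ''c'' 0 else 0"
  note defs = For_def[symmetric] scan_def reprice_def grow_def
  show ?thesis
    unfolding search_def
  proof (intro wp_Seq wp_NWrite,
      rule wp_While[where V = ?V and I = "\<lambda>\<mu>'. ?T \<mu>' \<and> (nmem \<mu>' ''done'' 0 \<noteq> 0 \<longrightarrow> ?Q \<mu>')"],
      goal_cases)
    case (3 \<mu>1)
    then have inst1: "instance_in \<mu>1" and mem1: "nmem \<mu>1 ''i'' 0 = i" "nmem \<mu>1 ''f'' = f" "nmem \<mu>1 ''deg'' = dg"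
      using inst by (simp_all add: frame_def instance_in_def i f dg scan_def reprice_def grow_def)
    from 3 have T1: "?T \<mu>1" and d1: "nmem \<mu>1 ''done'' 0 = 0" by simp_all
    define vs vt u p where mem: "vs = nmem \<mu>1 ''vs''" "vt = nmem \<mu>1 ''vt''" "u = rmem \<mu>1 ''u''" "p = rmem \<mu>1 ''p''"
    have c1: "nmem \<mu>1 ''c'' 0 \<le> m" using tree_count_le[OF T1] i by simp
    have start: "frontier vs vt (k + i)" using frontier_spare[OF T1 i(2)] by (simp add: mem)
    show ?case
    proof (intro wp_Seq, rule wp_conseq[OF wp_scan[OF inst1 mem1(1) B(1) mem[symmetric] start]], goal_cases)
      case (1 \<mu>2)
      then have inst2: "instance_in \<mu>2" and "rmem \<mu>2 = rmem \<mu>1"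
        and mem2: "\<And>x. x \<notin> {''best'', ''e''} \<Longrightarrow> nmem \<mu>2 x = nmem \<mu>1 x"
        using inst1 by (simp_all add: frame_def instance_in_def scan_def fun_eq_iff)
      define \<delta> where "\<delta> = slack u p (nmem \<mu>2 ''best'' 0)"
      have memd: "nmem \<mu>2 ''vs'' = vs" "nmem \<mu>2 ''vt'' = vt" "rmem \<mu>2 ''u'' = u" "rmem \<mu>2 ''p'' = p"
        by (simp_all add: \<open>rmem \<mu>2 = rmem \<mu>1\<close> mem2 mem)
      note best = 1(2)
      have B': "n \<le> B" "Suc m \<le> B" using B by simp_all
      show ?case
      proof (intro wp_Seq, rule wp_conseq[OF wp_reprice[OF inst2 B' memd \<delta>_def]], goal_cases)
        case (1 \<mu>3)
        then have inst3: "instance_in \<mu>3" and best3: "nmem \<mu>3 ''best'' 0 = nmem \<mu>2 ''best'' 0"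
          and mem3: "\<And>x. x \<notin> {''best'', ''e'', ''s'', ''t''} \<Longrightarrow> nmem \<mu>3 x = nmem \<mu>1 x"
          using inst2 mem2 by (simp_all add: frame_def instance_in_def reprice_def)
        have T3: "?T \<mu>3" and E3: "?E \<mu>3"
          using tree_reprice[OF T1 i(2), of "nmem \<mu>2 ''best'' 0" \<delta>] best 1(2)
          by (simp_all add: best3 mem3 mem[symmetric] \<delta>_def)
        show ?case
        proof (intro wp_If wp_NWrite, goal_cases)
          case 1
          then show ?case
            using T3 E3 inst3 d1 c1 by (simp add: instance_in_def mem3 mem1)
        next
          case 2
          then have le: "cap (tgt (nmem \<mu>3 ''best'' 0)) \<le> dg (tgt (nmem \<mu>3 ''best'' 0))"
            using inst3 by (simp add: instance_in_def mem3 mem1)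
          have iB: "i \<le> B" using i B by simp
          have mem3': "nmem \<mu>3 ''i'' 0 = i" "nmem \<mu>3 ''f'' = f" by (simp_all add: mem3 mem1)
          show ?case
          proof (rule wp_conseq[OF wp_grow[OF inst3 mem3'(1) iB refl refl mem3'(2) refl refl refl]],
              goal_cases)
            case (1 \<mu>4)
            then have mem4: "nmem \<mu>4 ''done'' 0 = 0" "rmem \<mu>4 = rmem \<mu>3"
              by (simp_all add: frame_def grow_def mem3 d1 fun_eq_iff)
            have "?T \<mu>4"
              using tree_grow[OF T3 i(2) conjunct1[OF E3] conjunct2[OF E3] refl le, of "nmem \<mu>4 ''vs''"] 1(2)
              by (simp add: mem4)
            then show ?case using 1(2) d1 c1 by (simp add: mem4 mem3)
          qed
        qed
      qed
    qed
  qed (use tree B in auto)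
qed

lemma wp_flip:
  assumes inst: "instance_in \<mu>" and i: "nmem \<mu> ''i'' 0 = i" "i < n" and B: "m \<le> B"
    and mem: "nmem \<mu> ''best'' 0 = e" "rmem \<mu> ''u'' = u" "rmem \<mu> ''p'' = p" "nmem \<mu> ''deg'' = dg"
      "nmem \<mu> ''vs'' = vs" "nmem \<mu> ''vt'' = vt" "nmem \<mu> ''pv'' = pv"
    and tree: "tree i (nmem \<mu> ''f'') u p dg vs vt pv c"
    and e: "frontier vs vt e" "tight u p e" "dg (tgt e) < cap (tgt e)"
  shows "wp B flip (\<lambda>\<mu>'. optimal_on (Suc i) (nmem \<mu>' ''f'') u p (nmem \<mu>' ''deg'')) \<mu>"
proof -
  let ?dg = "dg(tgt e := Suc (dg (tgt e)))"
  let ?I = "\<lambda>\<mu>'. flipping i (nmem \<mu>' ''f'') u p ?dg vt pv (nmem \<mu>' ''cur'' 0)"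
  \<comment> \<open>The time of discovery of the node about to lose an edge, at most
    \<open>c \<le> m\<close> at the start, and 0 once the root is reached.\<close>
  let ?V = "\<lambda>f e. if src e < i then vt (tgt (f (src e))) else 0"
  have f: "tgt (nmem \<mu> ''f'' s) \<le> m" if "s < i" for s
    using tree that tgt_le by (auto simp: tree_def optimal_on_def tight_on_def)
  have V: "?V (nmem \<mu> ''f'') e \<le> B"
  proof (cases "src e < i \<and> vt (tgt (nmem \<mu> ''f'' (src e))) \<noteq> 0")
    case True
    then have "vt (tgt (nmem \<mu> ''f'' (src e))) \<le> c"
      using tree f[of "src e"] unfolding tree_def by blast
    then show ?thesis using B tree_count_le[OF tree] i True by simp
  qed auto
  show ?thesis
    unfolding flip_def
  proof (intro wp_Seq wp_NWrite,
      rule wp_While[where I = ?I and V = "\<lambda>\<mu>'. ?V (nmem \<mu>' ''f'') (nmem \<mu>' ''cur'' 0)"], goal_cases)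
    case 1
    then show ?case
      using flipping_init[OF tree i(2) e] inst by (simp add: mem instance_in_def)
  next
    case 2
    then show ?case using V inst by (simp add: mem instance_in_def split: if_splits)
  next
    case (3 \<mu>')
    then have mem': "nmem \<mu>' ''source'' = src" "nmem \<mu>' ''target'' = tgt" "nmem \<mu>' ''pv'' = pv"
        "nmem \<mu>' ''i'' 0 = i"
      using inst by (simp_all add: frame_def instance_in_def mem i)
    with 3(3) have less: "src (nmem \<mu>' ''cur'' 0) < i" by simp
    have "0 < vt (tgt (nmem \<mu>' ''f'' (src (nmem \<mu>' ''cur'' 0))))"
      using 3(2) less by (simp add: flipping_def)
    then show ?case
      using flipping_step[OF 3(2) less] less
      by (intro wp_Seq wp_NWrite) (simp add: mem')
  next
    case (4 \<mu>')
    then have mem': "nmem \<mu>' ''source'' = src" "nmem \<mu>' ''i'' 0 = i" "nmem \<mu>' ''deg'' = ?dg"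
      using inst by (simp_all add: frame_def instance_in_def mem i)
    with 4(3) show ?case
      using flipping_final[OF 4(2)] by (intro wp_NWrite) (simp add: mem')
  qed
qed

lemma wp_solve:
  assumes inst: "instance_in \<mu>" and B: "k + n \<le> B" "m + 2 \<le> B"
    and init: "optimal_on 0 (nmem \<mu> ''f'') (rmem \<mu> ''u'') (rmem \<mu> ''p'') (nmem \<mu> ''deg'')"
  shows "wp B solve (\<lambda>\<mu>'. optimal_on n (nmem \<mu>' ''f'') (rmem \<mu>' ''u'') (rmem \<mu>' ''p'') (nmem \<mu>' ''deg'')) \<mu>"
  unfolding solve_def
proof (rule wp_For[where H = n and I = "\<lambda>i \<mu>'.
    optimal_on i (nmem \<mu>' ''f'') (rmem \<mu>' ''u'') (rmem \<mu>' ''p'') (nmem \<mu>' ''deg'')"], goal_cases)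
  case (7 i \<mu>1)
  have inst1: "instance_in \<mu>1"
    using 7(1) inst by (simp add: frame_def instance_in_def reset_def search_def flip_def scan_def reprice_def grow_def)
  have B': "n \<le> B" "Suc m \<le> B" "m \<le> B" using B by simp_all
  show ?case
  proof (intro wp_Seq, rule wp_conseq[OF wp_reset[OF inst1 7(2) B'(1,2)]], goal_cases)
    case (1 \<mu>2)
    then have inst2: "instance_in \<mu>2" and mem2: "nmem \<mu>2 ''i'' 0 = i" "nmem \<mu>2 ''f'' = nmem \<mu>1 ''f''"
      "nmem \<mu>2 ''deg'' = nmem \<mu>1 ''deg''" "rmem \<mu>2 = rmem \<mu>1"
      using inst1 7(2) by (simp_all add: frame_def instance_in_def reset_def fun_eq_iff)
    have tree2: "tree i (nmem \<mu>2 ''f'') (rmem \<mu>2 ''u'') (rmem \<mu>2 ''p'') (nmem \<mu>2 ''deg'')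
        (nmem \<mu>2 ''vs'') (nmem \<mu>2 ''vt'') (nmem \<mu>2 ''pv'') (nmem \<mu>2 ''c'' 0)"
      using tree_init[OF 7(4,3), of "nmem \<mu>2 ''vs''" "nmem \<mu>2 ''vt''"] 1(2) by (simp add: mem2)
    show ?case
    proof (intro wp_Seq, rule wp_conseq[OF wp_search[OF inst2 mem2(1) 7(3) B refl refl tree2]], goal_cases)
      case (1 \<mu>3)
      then have inst3: "instance_in \<mu>3" and mem3: "nmem \<mu>3 ''i'' 0 = i" "nmem \<mu>3 ''f'' = nmem \<mu>2 ''f''"
          "nmem \<mu>3 ''deg'' = nmem \<mu>2 ''deg''"
        using inst2 by (simp_all add: frame_def instance_in_def search_def scan_def reprice_def grow_def mem2(1))
      note found = 1(2)[folded mem3(2,3)]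
      show ?case
      proof (rule wp_conseq[OF wp_flip[OF inst3 mem3(1) 7(3) B'(3) refl refl refl refl refl refl refl
            conjunct1[OF found]]], goal_cases)
        case (4 \<mu>4)
        then show ?case by (simp add: frame_def flip_def)
      qed (use found in auto)
    qed
  qed
qed (use inst B init in \<open>simp_all add: instance_in_def reset_def search_def flip_def scan_def
      reprice_def grow_def\<close>)

end

lemma wp_collect:
  assumes sz: "nmem \<mu> ''n'' 0 = n" "n \<le> B" and t: "nmem \<mu> ''t'' 0 = t"
    and g: "\<And>s. s < n \<Longrightarrow> nmem \<mu> ''target'' (nmem \<mu> ''f'' s) = g s"
    and l: "map (nmem \<mu> ''l'') [0..<nmem \<mu> ''h'' 0] = xs"
  shows "wp B collect (\<lambda>\<mu>'. map (nmem \<mu>' ''l'') [0..<nmem \<mu>' ''h'' 0] = xs @ fibre n g t) \<mu>"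
  unfolding collect_def
proof (rule wp_For[where H = n and I = "\<lambda>j \<mu>'.
    map (nmem \<mu>' ''l'') [0..<nmem \<mu>' ''h'' 0] = xs @ fibre j g t"], goal_cases)
  case (7 j \<mu>')
  then have "nmem \<mu>' ''target'' (nmem \<mu>' ''f'' j) = g j" "nmem \<mu>' ''t'' 0 = t"
    using g by (simp_all add: frame_def t)
  with 7(2-4) show ?case
    by (intro wp_If wp_Skip wp_NWrite wp_Seq) (auto simp: fibre_def)
qed (use sz l in \<open>simp_all add: fibre_def\<close>)

lemma wp_arrange:
  assumes sz: "nmem \<mu> ''n'' 0 = n" "n \<le> B" "nmem \<mu> ''M'' 0 = Suc m" "Suc m \<le> B"
    and g: "\<And>s. s < n \<Longrightarrow> nmem \<mu> ''target'' (nmem \<mu> ''f'' s) = g s"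
    and P: "\<And>t. P t \<longleftrightarrow> \<not> nmem \<mu> ''deg'' t < nmem \<mu> ''cap'' t"
  shows "wp B arrange (\<lambda>\<mu>'. map (nmem \<mu>' ''l'') [0..<nmem \<mu>' ''h'' 0] =
    blocks n g P (Suc m) @ blocks n g (\<lambda>t. \<not> P t) (Suc m)) \<mu>"
  unfolding arrange_def
proof (intro wp_Seq wp_NWrite, rule wp_For[where H = "Suc m" and I = "\<lambda>j \<mu>'.
    map (nmem \<mu>' ''l'') [0..<nmem \<mu>' ''h'' 0] = blocks n g P j"], goal_cases)
  case (7 j \<mu>')
  then have mem: "nmem \<mu>' ''n'' 0 = n" "nmem \<mu>' ''target'' = nmem \<mu> ''target''"
      "nmem \<mu>' ''f'' = nmem \<mu> ''f''" "nmem \<mu>' ''deg'' = nmem \<mu> ''deg''" "nmem \<mu>' ''cap'' = nmem \<mu> ''cap''"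
    by (simp_all add: frame_def sz collect_def)
  show ?case
  proof (intro wp_If wp_Skip, goal_cases)
    case 1
    then show ?case using 7(2-4) P[of j] by (simp add: mem blocks_Suc)
  next
    case 2
    then show ?case
      using 7(2-4) P[of j] mem g sz
      by (intro wp_conseq[OF wp_collect[where n = n and g = g and t = j, OF _ _ _ _ 7(4)]])
        (simp_all add: blocks_Suc)
  qed
next
  case (8 \<mu>1)
  then have mem1: "nmem \<mu>1 ''n'' 0 = n" "nmem \<mu>1 ''M'' 0 = Suc m" "nmem \<mu>1 ''target'' = nmem \<mu> ''target''"
      "nmem \<mu>1 ''f'' = nmem \<mu> ''f''" "nmem \<mu>1 ''deg'' = nmem \<mu> ''deg''" "nmem \<mu>1 ''cap'' = nmem \<mu> ''cap''"
    by (simp_all add: frame_def sz collect_def)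
  note l = 8(2)
  show ?case
  proof (rule wp_For[where H = "Suc m" and I = "\<lambda>j \<mu>'.
      map (nmem \<mu>' ''l'') [0..<nmem \<mu>' ''h'' 0] =
        blocks n g P (Suc m) @ blocks n g (\<lambda>t. \<not> P t) j"], goal_cases)
    case (7 j \<mu>')
    then have mem: "nmem \<mu>' ''n'' 0 = n" "nmem \<mu>' ''target'' = nmem \<mu> ''target''"
        "nmem \<mu>' ''f'' = nmem \<mu> ''f''" "nmem \<mu>' ''deg'' = nmem \<mu> ''deg''" "nmem \<mu>' ''cap'' = nmem \<mu> ''cap''"
      by (simp_all add: frame_def mem1 collect_def)
    show ?case
    proof (intro wp_If wp_Skip, goal_cases)
      case 1
      then show ?case
        using 7(2-4) P[of j] mem g sz
        by (intro wp_conseq[OF wp_collect[where n = n and g = g and t = j, OF _ _ _ _ 7(4)]])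
          (simp_all add: blocks_Suc[of n g "\<lambda>t. \<not> P t"])
    next
      case 2
      then show ?case
        using 7(2-4) P[of j] by (simp add: mem blocks_Suc[of n g "\<lambda>t. \<not> P t"])
    qed
  qed (use l sz in \<open>simp_all add: mem1 collect_def blocks_def[of n g _ 0]\<close>)
qed (use sz in \<open>simp_all add: collect_def blocks_def\<close>)

lemma wp_transpose:
  assumes sz: "nmem \<mu> ''n'' 0 = n" "n \<le> B" "nmem \<mu> ''b'' 0 = b" "b \<le> B" "0 < b"
    and l: "nmem \<mu> ''l'' = l"
  shows "wp B transpose (\<lambda>\<mu>'. map (nmem \<mu>' ''order'') [0..<nmem \<mu>' ''h'' 0] = map l (columns n b b)) \<mu>"
  unfolding transpose_def
proof (intro wp_Seq wp_NWrite, rule wp_For[where H = b and I = "\<lambda>r \<mu>'.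
    map (nmem \<mu>' ''order'') [0..<nmem \<mu>' ''h'' 0] = map l (columns n b r)"], goal_cases)
  case (7 r \<mu>1)
  then have mem1: "nmem \<mu>1 ''n'' 0 = n" "nmem \<mu>1 ''b'' 0 = b" "nmem \<mu>1 ''l'' = l"
    by (simp_all add: frame_def sz l)
  let ?I = "\<lambda>\<mu>'. \<exists>c \<le> column n b r. nmem \<mu>' ''j'' 0 = r + c * b \<and>
    map (nmem \<mu>' ''order'') [0..<nmem \<mu>' ''h'' 0] = map l (columns n b r @ map (\<lambda>c. r + c * b) [0..<c])"
  show ?case
  proof (intro wp_Seq wp_NWrite,
      rule wp_While[where I = ?I and V = "\<lambda>\<mu>'. n - nmem \<mu>' ''j'' 0"], goal_cases)
    case 1
    then show ?case using 7(2-4) by (intro exI[of _ 0]) simp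
  next
    case 2
    then show ?case using sz by simp
  next
    case (3 \<mu>2)
    then have mem2: "nmem \<mu>2 ''n'' 0 = n" "nmem \<mu>2 ''b'' 0 = b" "nmem \<mu>2 ''l'' = l"
      by (simp_all add: frame_def mem1)
    from 3(2) obtain c where c: "nmem \<mu>2 ''j'' 0 = r + c * b"
      "map (nmem \<mu>2 ''order'') [0..<nmem \<mu>2 ''h'' 0] = map l (columns n b r @ map (\<lambda>c. r + c * b) [0..<c])"
      by blast
    have less: "r + c * b < n" using 3(3) c(1) by (simp add: mem2)
    then have "Suc c \<le> column n b r" using column_iff sz by (simp add: Suc_le_eq)
    then show ?case
      using c less sz(5)
      by (intro wp_Seq wp_NWrite conjI exI[of _ "Suc c"]) (simp_all add: mem2)
  next
    case (4 \<mu>2)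
    then have "nmem \<mu>2 ''n'' 0 = n" by (simp add: frame_def mem1)
    with 4 obtain c where c: "c \<le> column n b r" "\<not> r + c * b < n"
      "map (nmem \<mu>2 ''order'') [0..<nmem \<mu>2 ''h'' 0] = map l (columns n b r @ map (\<lambda>c. r + c * b) [0..<c])"
      by auto
    then have "c = column n b r" using column_iff[of b c n r] sz by simp
    then show ?case using c(3) by (simp add: columns_Suc)
  qed
qed (use sz in simp_all)

lemma wp_mark:
  assumes sz: "nmem \<mu> ''n'' 0 = n" "n \<le> B" and f: "nmem \<mu> ''f'' = f"
    and "nmem \<mu> ''matching'' = (\<lambda>_. 0)"
  shows "wp B mark (\<lambda>\<mu>'. \<forall>e. nmem \<mu>' ''matching'' e \<noteq> 0 \<longleftrightarrow> e \<in> f ` {..<n}) \<mu>"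
  unfolding mark_def
proof (rule wp_For[where H = n and I = "\<lambda>j \<mu>'.
    \<forall>e. nmem \<mu>' ''matching'' e \<noteq> 0 \<longleftrightarrow> e \<in> f ` {..<j}"], goal_cases)
  case (7 j \<mu>')
  then have "nmem \<mu>' ''f'' = f" by (simp add: frame_def f)
  with 7(2-4) show ?case by (intro wp_NWrite) (auto simp: less_Suc_eq)
qed (use assms in simp_all)

section \<open>Correctness of the encoding\<close>

text \<open>If \<open>b = 1\<close>, possibly with \<open>d > n\<close>, two positions never share a
  partner other than \<open>m\<close>, so the claim is vacuous; otherwise
  \<open>b * d \<le> n\<close> and \<open>columns_spread\<close> applies.\<close>

lemma (in capacity) columns_arrangement_spread:
  assumes d: "1 \<le> d" "b = 1 \<or> b * d \<le> n" and i: "i < n" "i' < n" "i \<noteq> i'"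
    and g: "g (arrangement ! (columns n b b ! i)) = g (arrangement ! (columns n b b ! i'))"
      "g (arrangement ! (columns n b b ! i)) \<noteq> m"
  shows "int d \<le> \<bar>int i - int i'\<bar> \<and> \<bar>int i - int i'\<bar> \<le> int n - int d"
proof -
  let ?c = "columns n b b"
  have main: "int d \<le> \<bar>int i - int i'\<bar> \<and> \<bar>int i - int i'\<bar> \<le> int n - int d"
    if "i < n" "i' < n" "?c ! i < ?c ! i'" "g (arrangement ! (?c ! i)) = g (arrangement ! (?c ! i'))"
      "g (arrangement ! (?c ! i)) \<noteq> m" for i i'
  proof -
    have close: "?c ! i div b = ?c ! i' div b \<or> ?c ! i' + 2 \<le> ?c ! i + b"
      using that columns_nth(1)[OF b_pos] by (intro arrangement_close) auto
    then have "b \<noteq> 1" using that(3) by auto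
    then show ?thesis
      using columns_spread[OF b_pos _ d(1) that(1,2) refl refl that(3) close] d(2) by blast
  qed
  have "?c ! i \<noteq> ?c ! i'"
    using i distinct_columns[OF b_pos order_refl] length_columns[OF b_pos]
    by (simp add: nth_eq_iff_index_eq)
  then consider "?c ! i < ?c ! i'" | "?c ! i' < ?c ! i" by linarith
  then show ?thesis
  proof cases
    case 1
    then show ?thesis using main[of i i'] i g by simp
  next
    case 2
    then show ?thesis using main[of i' i] i g by (simp add: abs_minus_commute)
  qed
qed

lemma (in capacity) bij_betw_arrangement_columns:
  "bij_betw (\<lambda>i. arrangement ! (columns n b b ! i)) {..<n} {..<n}"
proof -
  have "bij_betw ((!) (columns n b b)) {..<n} {..<n}"
    using bij_betw_nth[OF distinct_columns[OF b_pos order_refl]] b_pos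
    by (auto simp: length_columns set_columns lessThan_def)
  moreover have "bij_betw ((!) arrangement) {..<n} {..<n}"
    using bij_betw_nth[OF distinct_arrangement] by (simp add: length_arrangement set_arrangement)
  ultimately show ?thesis by (rule bij_betw_trans[unfolded comp_def])
qed

lemma map_upt_eqD:
  assumes "map f [0..<h] = xs" and "length xs = n"
  shows "h = n" and "i < n \<Longrightarrow> f i = xs ! i"
proof -
  show "h = n" using arg_cong[OF assms(1), of length] assms(2) by simp
  then show "f i = xs ! i" if "i < n" using that assms(1) by auto
qed

text \<open>\<open>ord i\<close> is the node at position \<open>i\<close>, and \<open>A\<close> is a set of edge numbers.\<close>

definition solution ::
    "nat \<Rightarrow> nat \<Rightarrow> nat \<Rightarrow> nat \<Rightarrow> (nat \<Rightarrow> nat) \<Rightarrow> (nat \<Rightarrow> nat) \<Rightarrow> (nat \<Rightarrow> real) \<Rightarrow>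
      (nat \<Rightarrow> nat) \<Rightarrow> nat set \<Rightarrow> bool" where
  "solution n m k d src tgt wt ord A \<longleftrightarrow>
     bij_betw ord {..<n} {..<n} \<and> A \<subseteq> {..<k} \<and> inj_on src A \<and>
     (\<forall>i<n. \<forall>i'<n. \<forall>e\<in>A. \<forall>e'\<in>A. i \<noteq> i' \<and> src e = ord i \<and> src e' = ord i' \<and> tgt e = tgt e' \<longrightarrow>
        int d \<le> \<bar>int i - int i'\<bar> \<and> \<bar>int i - int i'\<bar> \<le> int n - int d) \<and>
     (\<forall>F\<subseteq>{..<k}. inj_on src F \<and> (\<forall>t<m. card {e \<in> F. tgt e = t} \<le> max 1 (n div d)) \<longrightarrow>
        sum wt F \<le> sum wt A)"

lemma solutionI:
  assumes "bij_betw ord {..<n} {..<n}" "A \<subseteq> {..<k}" "inj_on src A"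
    and "\<And>i i' e e'. i < n \<Longrightarrow> i' < n \<Longrightarrow> e \<in> A \<Longrightarrow> e' \<in> A \<Longrightarrow> i \<noteq> i' \<Longrightarrow>
      src e = ord i \<Longrightarrow> src e' = ord i' \<Longrightarrow> tgt e = tgt e' \<Longrightarrow>
      int d \<le> \<bar>int i - int i'\<bar> \<and> \<bar>int i - int i'\<bar> \<le> int n - int d"
    and "\<And>F. F \<subseteq> {..<k} \<Longrightarrow> inj_on src F \<Longrightarrow>
      (\<And>t. t < m \<Longrightarrow> card {e \<in> F. tgt e = t} \<le> max 1 (n div d)) \<Longrightarrow> sum wt F \<le> sum wt A"
  shows "solution n m k d src tgt wt ord A"
  unfolding solution_def using assms by (intro conjI allI ballI impI) auto

lemma solution_maximal:
  assumes "solution n m k d src tgt wt ord A" "F \<subseteq> {..<k}" "inj_on src F"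
    and "\<And>t. t < m \<Longrightarrow> card {e \<in> F. tgt e = t} \<le> max 1 (n div d)"
  shows "sum wt F \<le> sum wt A"
  using assms unfolding solution_def by simp

lemma wp_algorithm:
  fixes n m k d :: nat
  assumes sz: "nmem \<mu> ''n'' 0 = n" "nmem \<mu> ''m'' 0 = m" "nmem \<mu> ''k'' 0 = k" "nmem \<mu> ''d'' 0 = d"
    and d: "1 \<le> d" and B: "k + n \<le> B" "m + 2 \<le> B"
    and zero: "nmem \<mu> ''deg'' = (\<lambda>_. 0)" "nmem \<mu> ''matching'' = (\<lambda>_. 0)" "rmem \<mu> ''p'' = (\<lambda>_. 0)"
      "rmem \<mu> ''U'' = (\<lambda>_. 0)"
    and graph: "\<And>e. e < k \<Longrightarrow> nmem \<mu> ''source'' e < n" "\<And>e. e < k \<Longrightarrow> nmem \<mu> ''target'' e < m"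
      "\<And>e. e < k \<Longrightarrow> 0 \<le> rmem \<mu> ''weight'' e" "\<And>e. k \<le> e \<Longrightarrow> rmem \<mu> ''weight'' e = 0"
  shows "wp B algorithm (\<lambda>\<mu>'. solution n m k d (nmem \<mu> ''source'') (nmem \<mu> ''target'')
      (rmem \<mu> ''weight'') (nmem \<mu>' ''order'') {e. e < k \<and> nmem \<mu>' ''matching'' e \<noteq> 0}) \<mu>"
proof -
  define b where "b = max 1 (n div d)"
  define src where "src = (\<lambda>e. if k \<le> e \<and> e < k + n then e - k else nmem \<mu> ''source'' e)"
  define tgt where "tgt = (\<lambda>e. if k \<le> e \<and> e < k + n then m else nmem \<mu> ''target'' e)"
  define wt where "wt = rmem \<mu> ''weight''"
  have B': "n \<le> B" "m \<le> B" "k \<le> B" "Suc m \<le> B" using B by simp_all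
  have b: "0 < b" "b = 1 \<or> b * d \<le> n" using d by (auto simp: b_def max_def)
  have "b \<le> max 1 n" unfolding b_def by (rule max.mono) simp_all
  then have bB: "b \<le> B" using B by simp
  \<comment> \<open>Numbers from \<open>k\<close> on have weight 0, so the bound covers the spare
    edges too.\<close>
  have wt_le: "wt e \<le> (\<Sum>e<k. wt e)" for e
    using graph(3,4) member_le_sum[of e "{..<k}" wt] sum_nonneg[of "{..<k}" wt]
    by (cases "e < k") (auto simp: wt_def)
  show ?thesis
    unfolding algorithm_def
  proof (intro wp_Seq, rule wp_conseq[OF wp_quotient[OF sz(1,4) d B'(1)]], goal_cases)
    case (1 \<mu>1)
    then have sz1: "nmem \<mu>1 ''n'' 0 = n" "nmem \<mu>1 ''m'' 0 = m" "nmem \<mu>1 ''k'' 0 = k" "nmem \<mu>1 ''b'' 0 = b"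
      and U: "rmem \<mu>1 ''U'' 0 = 0" and mem1: "rmem \<mu>1 = rmem \<mu>"
        "nmem \<mu>1 ''deg'' = nmem \<mu> ''deg''" "nmem \<mu>1 ''matching'' = nmem \<mu> ''matching''"
        "nmem \<mu>1 ''source'' = nmem \<mu> ''source''" "nmem \<mu>1 ''target'' = nmem \<mu> ''target''"
      by (simp_all add: frame_def quotient_def sz zero b_def fun_eq_iff)
    show ?case
    proof (intro wp_Seq, rule wp_conseq[OF wp_extend[OF sz1 U B'(1-3)]], goal_cases)
      case (1 \<mu>2)
      define cap where "cap = nmem \<mu>2 ''cap''"
      have cap: "\<And>t. t < m \<Longrightarrow> cap t = b" "cap m = Suc n" using 1(2) by (simp_all add: cap_def)
      interpret assignment n m k src tgt cap wt
        using graph cap by unfold_locales (auto simp: src_def tgt_def wt_def less_imp_le)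
      have inst2: "instance_in \<mu>2" and mem2: "nmem \<mu>2 ''deg'' = (\<lambda>_. 0)" "rmem \<mu>2 ''p'' = (\<lambda>_. 0)"
        "nmem \<mu>2 ''matching'' = (\<lambda>_. 0)" "nmem \<mu>2 ''b'' 0 = b"
        using 1 unfolding instance_in_def
        by (simp_all add: frame_def extend_def sz1 mem1 zero src_def tgt_def wt_def cap_def cong: if_cong)
      have "\<forall>s<n. rmem \<mu>2 ''u'' s = (\<Sum>e<k. wt e)" using 1(2) by (simp add: mem1 wt_def)
      then have opt2: "optimal_on 0 (nmem \<mu>2 ''f'') (rmem \<mu>2 ''u'') (rmem \<mu>2 ''p'') (nmem \<mu>2 ''deg'')"
        using wt_le src_less
        by (simp add: optimal_on_def feasible_def tight_on_def slackness_def mem2)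
      show ?case
      proof (intro wp_Seq, rule wp_conseq[OF wp_solve[OF inst2 B opt2]], goal_cases)
        case (1 \<mu>3)
        define f where "f = nmem \<mu>3 ''f''"
        define P where "P = (\<lambda>t. \<not> nmem \<mu>3 ''deg'' t < cap t)"
        define g where "g = (\<lambda>s. tgt (f s))"
        from 1(2) have opt: "optimal_on n f (rmem \<mu>3 ''u'') (rmem \<mu>3 ''p'') (nmem \<mu>3 ''deg'')"
          by (simp add: f_def)
        have inst3: "instance_in \<mu>3" and mem3: "nmem \<mu>3 ''matching'' = (\<lambda>_. 0)" "nmem \<mu>3 ''b'' 0 = b"
          using 1(1) inst2 mem2 by (simp_all add: frame_def instance_in_def solve_def reset_def search_def
              flip_def scan_def reprice_def grow_def)
        have edge: "\<And>s. s < n \<Longrightarrow> f s < k + n \<and> src (f s) = s"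
          using opt by (simp add: optimal_on_def tight_on_def)
        have load: "card {s. s < n \<and> g s = t} = nmem \<mu>3 ''deg'' t" "nmem \<mu>3 ''deg'' t \<le> cap t"
          if "t \<le> m" for t
          using opt that by (auto simp: optimal_on_def load_def g_def slackness_def)
        interpret capacity n m b g P
        proof
          show "\<not> P m" using spare_unsaturated(1)[OF opt] by (simp add: P_def)
          show "card {s. s < n \<and> g s = t} = b" if "t < m" "P t" for t
            using load[of t] that cap(1) by (simp add: P_def)
          show "card {s. s < n \<and> g s = t} < b" if "t < m" "\<not> P t" for t
            using load[of t] that cap(1) by (simp add: P_def)
        qed (use edge tgt_le b in \<open>auto simp: g_def\<close>)
        have n3: "nmem \<mu>3 ''n'' 0 = n" "nmem \<mu>3 ''M'' 0 = Suc m"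
          using inst3 by (simp_all add: instance_in_def)
        have g3: "nmem \<mu>3 ''target'' (nmem \<mu>3 ''f'' s) = g s" for s
          using inst3 by (simp add: instance_in_def g_def f_def)
        have P3: "P t \<longleftrightarrow> \<not> nmem \<mu>3 ''deg'' t < nmem \<mu>3 ''cap'' t" for t
          using inst3 by (simp add: instance_in_def P_def)
        show ?case
        proof (intro wp_Seq, rule wp_conseq[OF wp_arrange[where P = P, OF n3(1) B'(1) n3(2) B'(4) g3 P3]],
            goal_cases)
          case (1 \<mu>4)
          then have mem4: "nmem \<mu>4 ''n'' 0 = n" "nmem \<mu>4 ''b'' 0 = b" "nmem \<mu>4 ''matching'' = (\<lambda>_. 0)"
              "nmem \<mu>4 ''f'' = f"
            by (simp_all add: frame_def arrange_def collect_def n3 mem3 f_def)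
          have l: "nmem \<mu>4 ''l'' i = arrangement ! i" if "i < n" for i
            using map_upt_eqD(2)[OF 1(2)[folded arrangement_def] length_arrangement that] .
          show ?case
          proof (intro wp_Seq, rule wp_conseq[OF wp_transpose[OF mem4(1) B'(1) mem4(2) bB b(1) refl]],
              goal_cases)
            case (1 \<mu>5)
            then have mem5: "nmem \<mu>5 ''n'' 0 = n" "nmem \<mu>5 ''f'' = f" "nmem \<mu>5 ''matching'' = (\<lambda>_. 0)"
              by (simp_all add: frame_def transpose_def mem4)
            have order5: "nmem \<mu>5 ''order'' i = arrangement ! (columns n b b ! i)" if "i < n" for i
              using map_upt_eqD(2)[OF 1(2) _ that] l columns_nth(1)[OF b(1) that] that
              by (simp add: length_columns[OF b(1)])
            show ?case
            proof (rule wp_conseq[OF wp_mark[OF mem5(1) B'(1) mem5(2,3)]], goal_cases)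
              case (1 \<mu>6)
              let ?ord = "nmem \<mu>6 ''order''" and ?A = "{e. e < k \<and> nmem \<mu>6 ''matching'' e \<noteq> 0}"
              have ord: "?ord i = arrangement ! (columns n b b ! i)" if "i < n" for i
                using 1(1) order5[OF that] by (simp add: frame_def mark_def)
              \<comment> \<open>The intersection drops the spare edges: nodes assigned to them count
                as unmatched.\<close>
              have A: "?A = f ` {..<n} \<inter> {..<k}" using 1(2) by auto
              have old: "nmem \<mu> ''source'' e = src e" "nmem \<mu> ''target'' e = tgt e" if "e < k" for e
                using that by (simp_all add: src_def tgt_def)
              have fsrc: "f (src e) = e" if "e \<in> ?A" for e
                using that edge unfolding A by auto
              have bij: "bij_betw ?ord {..<n} {..<n}"
                using bij_betw_arrangement_columns ord by (subst bij_betw_cong) auto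
              have inj: "inj_on (nmem \<mu> ''source'') ?A"
                using old fsrc by (auto intro!: inj_onI) metis
              have spread: "int d \<le> \<bar>int i - int i'\<bar> \<and> \<bar>int i - int i'\<bar> \<le> int n - int d"
                if "i < n" "i' < n" "e \<in> ?A" "e' \<in> ?A" "i \<noteq> i'" "nmem \<mu> ''source'' e = ?ord i"
                  "nmem \<mu> ''source'' e' = ?ord i'" "nmem \<mu> ''target'' e = nmem \<mu> ''target'' e'" for i i' e e'
              proof -
                have "f (?ord i) = e" "f (?ord i') = e'"
                  using that(3,4,6,7) old(1)[of e] old(1)[of e'] fsrc[of e] fsrc[of e'] by simp_all
                then have "g (?ord i) = tgt e" "g (?ord i') = tgt e'" by (simp_all add: g_def)
                moreover have "tgt e = tgt e'" "tgt e \<noteq> m"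
                  using that(3,4,8) old graph(2)[of e] by auto
                ultimately show ?thesis
                  using that(1,2,5) ord by (intro columns_arrangement_spread[OF d b(2)]) simp_all
              qed
              have max: "sum wt F \<le> sum wt ?A"
                if F: "F \<subseteq> {..<k}" "inj_on (nmem \<mu> ''source'') F"
                  "\<And>t. t < m \<Longrightarrow> card {e \<in> F. nmem \<mu> ''target'' e = t} \<le> b" for F
              proof -
                have eq: "{e \<in> F. nmem \<mu> ''target'' e = t} = {e \<in> F. tgt e = t}" for t
                  using F(1) old(2) by force
                have "inj_on src F \<longleftrightarrow> inj_on (nmem \<mu> ''source'') F"
                  using F(1) old(1) by (intro inj_on_cong) auto
                then have "inj_on src F" using F(2) by simp
                then have "sum wt F \<le> (\<Sum>s<n. wt (f s))"
                  using F(1,3) cap(1) unfolding eq by (intro optimal_weight[OF opt]) auto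
                also have "\<dots> = sum wt (f ` {..<n})"
                  using edge by (intro sum.reindex_cong[symmetric, where l = f] refl inj_onI) (auto, metis)
                \<comment> \<open>The dropped spare edges have weight 0.\<close>
                also have "\<dots> = sum wt ?A"
                  unfolding A using graph(4) by (intro sum.mono_neutral_right) (auto simp: wt_def, meson not_le)
                finally show ?thesis .
              qed
              have sub: "?A \<subseteq> {..<k}" by auto
              show ?case
                by (rule solutionI[OF bij sub inj spread max[unfolded b_def wt_def]])
            qed
          qed
        qed
      qed
    qed
  qed
qed

section \<open>From memory contents back to graphs and matchings\<close>

lemma index_of_less:
  assumes "x \<in> set xs"
  shows "index_of xs x < length xs" and "xs ! index_of xs x = x"
proof -
  obtain i where "i < length xs \<and> xs ! i = x" using assms by (auto simp: in_set_conv_nth)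
  then have "index_of xs x < length xs \<and> xs ! index_of xs x = x"
    unfolding index_of_def by (rule LeastI)
  then show "index_of xs x < length xs" "xs ! index_of xs x = x" by auto
qed

text \<open>Distinct positions hold distinct nodes, so the degree of \<open>t\<close> is the number
  of positions of its neighbours, to which \<open>card_spread_cyclic\<close> applies unless the
  degree is at most 1.\<close>

lemma cyclic_distance_matching_degree:
  assumes "finite S" "\<sigma> \<in> permutations_of_set S" "E \<subseteq> S \<times> T" "1 \<le> d"
    and M: "cyclic_distance_matching d E \<sigma> M"
  shows "card {e \<in> M. snd e = t} \<le> max 1 (length \<sigma> div d)"
proof (rule ccontr)
  assume many: "\<not> ?thesis"
  let ?A = "{i. i < length \<sigma> \<and> (\<sigma> ! i, t) \<in> M}"
  have ME: "M \<subseteq> S \<times> T" using M assms(3) by (auto simp: cyclic_distance_matching_def)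
  have \<sigma>: "set \<sigma> = S" "distinct \<sigma>" using assms(2) by (auto simp: permutations_of_set_def)
  have "bij_betw (\<lambda>i. (\<sigma> ! i, t)) ?A {e \<in> M. snd e = t}"
    unfolding bij_betw_def
  proof
    show "inj_on (\<lambda>i. (\<sigma> ! i, t)) ?A"
      using \<sigma>(2) by (auto intro!: inj_onI simp: nth_eq_iff_index_eq)
    show "(\<lambda>i. (\<sigma> ! i, t)) ` ?A = {e \<in> M. snd e = t}"
    proof
      show "{e \<in> M. snd e = t} \<subseteq> (\<lambda>i. (\<sigma> ! i, t)) ` ?A"
      proof
        fix e assume e: "e \<in> {e \<in> M. snd e = t}"
        then have "fst e \<in> set \<sigma>" using ME \<sigma>(1) by auto
        then obtain i where "i < length \<sigma>" "\<sigma> ! i = fst e" by (auto simp: in_set_conv_nth)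
        then show "e \<in> (\<lambda>i. (\<sigma> ! i, t)) ` ?A"
          using e by (intro image_eqI[of _ _ i]) auto
      qed
    qed auto
  qed
  then have card: "card ?A = card {e \<in> M. snd e = t}" by (rule bij_betw_same_card)
  have "card ?A * d \<le> length \<sigma>"
  proof (rule card_spread_cyclic)
    show "2 \<le> card ?A" using many card by simp
    fix i j assume "i \<in> ?A" "j \<in> ?A" "i \<noteq> j"
    then show "int d \<le> \<bar>int i - int j\<bar> \<and> \<bar>int i - int j\<bar> \<le> int (length \<sigma>) - int d"
      using M unfolding cyclic_distance_matching_def by blast
  qed auto
  then have "card ?A \<le> length \<sigma> div d"
    using assms(4) by (simp add: less_eq_div_iff_mult_less_eq)
  then show False using many card by simp
qed

locale encoded_graph =
  fixes S :: "'s set" and T :: "'t set" and E :: "('s \<times> 't) set" and w :: "'s \<times> 't \<Rightarrow> real"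
    and d :: nat and ss ts es
  assumes fin: "finite S" "finite T" and E: "E \<subseteq> S \<times> T" and w: "\<And>e. e \<in> E \<Longrightarrow> 0 \<le> w e"
    and d: "1 \<le> d"
    and lists: "ss \<in> permutations_of_set S" "ts \<in> permutations_of_set T" "es \<in> permutations_of_set E"
begin

abbreviation source :: "nat \<Rightarrow> nat" where "source \<equiv> nmem (input_state ss ts es w d) ''source''"
abbreviation target :: "nat \<Rightarrow> nat" where "target \<equiv> nmem (input_state ss ts es w d) ''target''"
abbreviation weight :: "nat \<Rightarrow> real" where "weight \<equiv> rmem (input_state ss ts es w d) ''weight''"

lemma sets: "set ss = S" "distinct ss" "set ts = T" "distinct ts" "set es = E" "distinct es"
  using lists by (auto simp: permutations_of_set_def)

lemma lengths: "length ss = card S" "length ts = card T" "length es = card E"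
  using sets distinct_card by fastforce+

lemma edge:
  assumes "e < length es"
  shows "source e < length ss" "ss ! source e = fst (es ! e)"
    "target e < length ts" "ts ! target e = snd (es ! e)" "weight e = w (es ! e)"
proof -
  have "es ! e \<in> S \<times> T" using assms E sets(5) nth_mem by blast
  then show "source e < length ss" "ss ! source e = fst (es ! e)"
    "target e < length ts" "ts ! target e = snd (es ! e)"
    using assms index_of_less[of "fst (es ! e)" ss] index_of_less[of "snd (es ! e)" ts] sets
    by (auto simp: input_state_def mem_Times_iff)
qed (use assms in \<open>simp add: input_state_def\<close>)

lemma nth_es_inj: "inj_on ((!) es) {..<length es}"
  using sets(6) by (auto intro!: inj_onI simp: nth_eq_iff_index_eq)

lemma sum_nth_es: "A \<subseteq> {..<length es} \<Longrightarrow> sum w ((!) es ` A) = sum weight A"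
  using edge(5) by (subst sum.reindex[OF inj_on_subset[OF nth_es_inj]]) (auto intro!: sum.cong)

text \<open>Whatever the ordering \<open>\<sigma>'\<close>, the edge numbers of \<open>M'\<close>
  form a set that meets the degree bounds in \<open>solution\<close>. So both maximality claims of
  the theorem follow at once.\<close>

lemma solution_optimal:
  assumes sol: "solution (length ss) (length ts) (length es) d source target weight ord A"
    and M': "\<sigma>' \<in> permutations_of_set S" "cyclic_distance_matching d E \<sigma>' M'"
  shows "sum w M' \<le> sum w ((!) es ` A)"
proof -
  have len: "length \<sigma>' = length ss"
    using M'(1) lists(1) by (simp add: length_finite_permutations_of_set)
  let ?F = "{e. e < length es \<and> es ! e \<in> M'}"
  have sub: "M' \<subseteq> E" and deg: "\<And>s. s \<in> S \<Longrightarrow> card {e \<in> M'. fst e = s} \<le> 1"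
    using M' by (auto simp: cyclic_distance_matching_def permutations_of_set_def)
  have finM: "finite M'" using sub sets(5) by (metis List.finite_set finite_subset)
  have img: "M' = (!) es ` ?F"
  proof
    show "M' \<subseteq> (!) es ` ?F"
    proof
      fix e assume e: "e \<in> M'"
      then have "e \<in> set es" using sub sets(5) by blast
      then obtain i where "i < length es" "es ! i = e" by (auto simp: in_set_conv_nth)
      then show "e \<in> (!) es ` ?F" using e by blast
    qed
  qed auto
  have "inj_on source ?F"
  proof (rule inj_onI)
    fix e e' assume e: "e \<in> ?F" "e' \<in> ?F" "source e = source e'"
    then have fst: "fst (es ! e) = fst (es ! e')" using edge(2)[of e] edge(2)[of e'] by simp
    have "fst (es ! e) \<in> S" using e E sets(5) by (auto dest!: nth_mem)
    then have one: "card {x \<in> M'. fst x = fst (es ! e)} \<le> Suc 0" using deg by simp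
    have "finite {x \<in> M'. fst x = fst (es ! e)}" using finM by simp
    from card_le_Suc0_iff_eq[OF this] one
    have "\<forall>x \<in> {x \<in> M'. fst x = fst (es ! e)}. \<forall>y \<in> {x \<in> M'. fst x = fst (es ! e)}. x = y"
      by simp
    moreover have "es ! e \<in> {x \<in> M'. fst x = fst (es ! e)}" "es ! e' \<in> {x \<in> M'. fst x = fst (es ! e)}"
      using e fst by simp_all
    ultimately have "es ! e = es ! e'" by blast
    then show "e = e'" using e sets(6) by (simp add: nth_eq_iff_index_eq)
  qed
  moreover have "card {e \<in> ?F. target e = t} \<le> max 1 (length ss div d)" if "t < length ts" for t
  proof -
    have "card {e \<in> ?F. target e = t} = card ((!) es ` {e \<in> ?F. target e = t})"
      by (intro card_image[symmetric] inj_on_subset[OF nth_es_inj]) auto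
    also have "\<dots> \<le> card {e \<in> M'. snd e = ts ! t}"
      using finM edge(4) by (intro card_mono) auto
    also have "\<dots> \<le> max 1 (length ss div d)"
      using cyclic_distance_matching_degree[OF fin(1) M'(1) E d M'(2)] len by simp
    finally show ?thesis .
  qed
  ultimately have "sum weight ?F \<le> sum weight A"
    by (intro solution_maximal[OF sol]) auto
  moreover have "sum w M' = sum weight ?F"
    by (subst img, rule sum_nth_es) auto
  moreover have "sum w ((!) es ` A) = sum weight A"
    using sol by (intro sum_nth_es) (simp add: solution_def)
  ultimately show ?thesis by simp
qed

lemma solution_order:
  assumes "bij_betw ord {..<length ss} {..<length ss}"
  shows "map (\<lambda>i. ss ! ord i) [0..<length ss] \<in> permutations_of_set S"
proof -
  have "bij_betw ((!) ss) {..<length ss} S"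
    using bij_betw_nth[OF sets(2), of "{..<length ss}" S] sets(1) by simp
  from bij_betw_trans[OF assms this] show ?thesis
    by (auto simp: permutations_of_set_def bij_betw_def distinct_map comp_def atLeast0LessThan)
qed

lemma solution_matching:
  assumes sol: "solution (length ss) (length ts) (length es) d source target weight ord A"
  shows "cyclic_distance_matching d E (map (\<lambda>i. ss ! ord i) [0..<length ss]) ((!) es ` A)"
    (is "cyclic_distance_matching d E ?\<sigma> ?M")
proof -
  have bij: "bij_betw ord {..<length ss} {..<length ss}" and A: "A \<subseteq> {..<length es}"
    and inj: "inj_on source A"
    and spread: "\<And>i i' e e'. i < length ss \<Longrightarrow> i' < length ss \<Longrightarrow> e \<in> A \<Longrightarrow> e' \<in> A \<Longrightarrow> i \<noteq> i' \<Longrightarrow>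
      source e = ord i \<Longrightarrow> source e' = ord i' \<Longrightarrow> target e = target e' \<Longrightarrow>
      int d \<le> \<bar>int i - int i'\<bar> \<and> \<bar>int i - int i'\<bar> \<le> int (length ss) - int d"
    using sol unfolding solution_def by blast+
  have fin: "finite A" using A finite_subset by blast
  have "?M \<subseteq> E" using A sets(5) by auto
  moreover have "card {e \<in> ?M. fst e = s} \<le> 1" for s
  proof -
    have "x = y" if xy: "x \<in> ?M" "y \<in> ?M" "fst x = s" "fst y = s" for x y
    proof -
      obtain e e' where e: "e \<in> A" "e' \<in> A" "x = es ! e" "y = es ! e'" using xy by auto
      then have "e < length es" "e' < length es" using A by auto
      then have "ss ! source e = ss ! source e'" "source e < length ss" "source e' < length ss"
        using xy e edge(1,2) by simp_all
      then have "source e = source e'" using sets(2) by (simp add: nth_eq_iff_index_eq)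
      then show "x = y" using e inj by (auto dest: inj_onD)
    qed
    then show ?thesis using fin by (simp add: card_le_Suc0_iff_eq)
  qed
  moreover have "int d \<le> \<bar>int i - int j\<bar> \<and> \<bar>int i - int j\<bar> \<le> int (length ss) - int d"
    if ij: "i < length ss" "j < length ss" "(ss ! ord i, t) \<in> ?M" "(ss ! ord j, t) \<in> ?M" "i \<noteq> j" for i j t
  proof -
    obtain e e' where e: "e \<in> A" "e' \<in> A" "es ! e = (ss ! ord i, t)" "es ! e' = (ss ! ord j, t)"
      using ij by auto
    have ord: "ord i < length ss" "ord j < length ss" using bij ij by (auto simp: bij_betw_def)
    have less: "e < length es" "e' < length es" using e A by auto
    have "source e = ord i" "source e' = ord j"
      using edge[OF less(1)] edge[OF less(2)] e ord sets(2) by (simp_all add: nth_eq_iff_index_eq)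
    moreover have "ts ! target e = ts ! target e'"
      using edge(4) less e by simp
    then have "target e = target e'"
      using nth_eq_iff_index_eq[OF sets(4)] edge(3) less by blast
    ultimately show ?thesis using spread ij e by blast
  qed
  ultimately show ?thesis
    unfolding cyclic_distance_matching_def
    by (simp del: image_iff) blast
qed

end

theorem theorem6:
  shows "\<exists>(c :: com) (q :: nat poly).
    \<forall>(S :: 's set) (T :: 't set) (E :: ('s \<times> 't) set) (w :: 's \<times> 't \<Rightarrow> real) (d :: nat) ss ts es.
      finite S \<and> finite T \<and> E \<subseteq> S \<times> T \<and> (\<forall>e \<in> E. 0 \<le> w e) \<and> 1 \<le> d \<and>
      ss \<in> permutations_of_set S \<and> ts \<in> permutations_of_set T \<and> es \<in> permutations_of_set E \<longrightarrow>
      (\<exists>t \<mu> \<sigma> M.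
         exec c (input_state ss ts es w d) t \<mu> \<and>
         t \<le> poly q (card S + card T + card E) \<and>
         valid_output ss \<mu> \<and> \<sigma> = output_order ss \<mu> \<and> M = output_matching es \<mu> \<and>
         \<sigma> \<in> permutations_of_set S \<and>
         cyclic_distance_matching d E \<sigma> M \<and>
         (\<forall>M'. cyclic_distance_matching d E \<sigma> M' \<longrightarrow> sum w M' \<le> sum w M) \<and>
         (\<forall>\<sigma>' \<in> permutations_of_set S. \<forall>M'.
            cyclic_distance_matching d E \<sigma>' M' \<longrightarrow> sum w M' \<le> sum w M))"
\<comment> \<open>The polynomial \<open>[:2, 1:]\<close> is \<open>x + 2\<close>, so every loop gets
  the bound \<open>card S + card T + card E + 2\<close>. The summand 2 stems from the variant of
  \<open>search\<close>.\<close>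
proof (intro exI[of _ algorithm] exI[of _ "pcompose (cost algorithm) [:2, 1:]"] allI impI)
  fix S :: "'s set" and T :: "'t set" and E and w :: "'s \<times> 't \<Rightarrow> real" and d :: nat and ss ts es
  assume "finite S \<and> finite T \<and> E \<subseteq> S \<times> T \<and> (\<forall>e \<in> E. 0 \<le> w e) \<and> 1 \<le> d \<and>
      ss \<in> permutations_of_set S \<and> ts \<in> permutations_of_set T \<and> es \<in> permutations_of_set E"
  then interpret encoded_graph S T E w d ss ts es
    by unfold_locales auto
  let ?\<mu> = "input_state ss ts es w d" and ?B = "card S + card T + card E + 2"
  have "wp ?B algorithm (\<lambda>\<mu>'. solution (length ss) (length ts) (length es) d source target
      weight (nmem \<mu>' ''order'') {e. e < length es \<and> nmem \<mu>' ''matching'' e \<noteq> 0}) ?\<mu>"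
  proof (rule wp_algorithm)
    show "0 \<le> weight e" if "e < length es" for e
      using that edge(5)[OF that] w[of "es ! e"] sets(5) nth_mem[OF that] by simp
  qed (use edge d in \<open>simp_all add: lengths[symmetric]\<close>, simp_all add: input_state_def fun_eq_iff)
  then obtain t \<mu> where run: "exec algorithm ?\<mu> t \<mu>" "t \<le> poly (cost algorithm) ?B"
    and sol: "solution (length ss) (length ts) (length es) d source target
      weight (nmem \<mu> ''order'') {e. e < length es \<and> nmem \<mu> ''matching'' e \<noteq> 0}"
    unfolding wp_def by blast
  have M: "output_matching es \<mu> = (!) es ` {e. e < length es \<and> nmem \<mu> ''matching'' e \<noteq> 0}"
    by (auto simp: output_matching_def)
  have bij: "bij_betw (nmem \<mu> ''order'') {..<length ss} {..<length ss}"
    using sol by (simp add: solution_def)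
  have "poly (pcompose (cost algorithm) [:2, 1:]) (card S + card T + card E) = poly (cost algorithm) ?B"
    by (simp add: poly_pcompose add.commute)
  moreover have "valid_output ss \<mu>"
    using bij by (auto simp: valid_output_def bij_betw_def)
  ultimately show "\<exists>t \<mu> \<sigma> M.
         exec algorithm ?\<mu> t \<mu> \<and>
         t \<le> poly (pcompose (cost algorithm) [:2, 1:]) (card S + card T + card E) \<and>
         valid_output ss \<mu> \<and> \<sigma> = output_order ss \<mu> \<and> M = output_matching es \<mu> \<and>
         \<sigma> \<in> permutations_of_set S \<and>
         cyclic_distance_matching d E \<sigma> M \<and>
         (\<forall>M'. cyclic_distance_matching d E \<sigma> M' \<longrightarrow> sum w M' \<le> sum w M) \<and>
         (\<forall>\<sigma>' \<in> permutations_of_set S. \<forall>M'.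
            cyclic_distance_matching d E \<sigma>' M' \<longrightarrow> sum w M' \<le> sum w M)"
    using run(1) run(2) solution_order[OF bij, folded output_order_def]
      solution_matching[OF sol, folded M output_order_def] solution_optimal[OF sol, folded M]
    by (metis (no_types, lifting))
qed

end
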